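(* Let $q$ be a complex number with $0<|q|<1$, and for $r\in\{1,2\}$ put $$w_r:=q^{r/2}\frac{f_rf_{21r}}{f_{3r}f_{7r}}.$$ If $P:=w_1w_2$ and $Q:=\dfrac{w_1}{w_2}$, then $$P+\frac{1}{P}=Q^3+\frac{1}{Q^3}+4\left(Q+\frac{1}{Q}\right).$$
   Context: For $|q|<1$, $f(-q):=\sum_{n=-\infty}^{\infty}(-1)^n q^{n(3n-1)/2}$, and $f_n:=f(-q^n)$ for positive integers $n$ (so $f_n$ is $f(-x)$ evaluated at $x=q^n$). A square root $q^{1/2}$ of $q$ is fixed (the positive one if $0<q<1$) and $q^{r/2}:=(q^{1/2})^r$. *)

theory Defs
  imports "HOL-Analysis.Analysis"
begin

text \<open>
  \<open>f_minus q\<close> is Ramanujan's \<open>f(-q)\<close>, as a function of \<open>q\<close> (not of \<open>-q\<close>). The integer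
  \<open>n * (3 * n - 1)\<close> is always even and nonnegative, so the division is exact and the exponent
  is never negative.
\<close>

definition f_minus :: "complex \<Rightarrow> complex" where
  "f_minus q = (\<Sum>\<^sub>\<infinity>n::int. (-1) powi n * q powi (n * (3 * n - 1) div 2))"

definition f_sub :: "complex \<Rightarrow> nat \<Rightarrow> complex" where
  "f_sub q n = f_minus (q ^ n)"

end

theory Submission
  imports Defs "HOL-Complex_Analysis.Complex_Analysis" "HOL-Probability.Characteristic_Functions"
begin

text \<open>
  Put \<open>A = w\<^sub>1\<^sup>2\<close> and \<open>B = w\<^sub>2\<^sup>2\<close>. After multiplication by \<open>A B (A B)\<^bsup>1/2\<^esup>\<close> the identity reads
  \<open>(A + B)\<^sup>3 = A B (1 - A) (1 - B)\<close>. With \<open>q = exp (2 \<pi> \<i> \<tau>)\<close>, both \<open>A\<close> and \<open>B\<close> are quotients of values of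
  \<open>\<eta>\<^sup>2\<close>, and the elements of \<open>\<Gamma>\<^sub>0(42)\<close> and the Atkin--Lehner involutions only exchange \<open>A\<close> with \<open>B\<close> or
  replace both by their inverses. The square of the difference of the two sides, divided by
  \<open>(A B)\<^sup>3\<close>, is invariant under all of them. The group they generate has a single cusp, and there
  the first two terms of the \<open>q\<close>-expansions show that the function tends to zero. So its modulus
  attains a maximum in the upper half plane, and the function is constant, hence zero.

  The transformation law of \<open>\<eta>\<^sup>2\<close> under \<open>\<tau> \<mapsto> - 1 / \<tau>\<close> comes from Poisson summation for Gaussians, which
  is reduced by Stone--Weierstrass to the uniqueness of Fourier coefficients.
\<close>

section \<open>The pentagonal number theorem\<close>

text \<open>As a series, \<open>f_minus\<close> suits Poisson summation, but its lack of zeros is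
  hidden. The pentagonal number theorem supplies the product that makes the quotients and the
  divisions by A and B legitimate. General multiplier systems and Dedekind sums are avoided. Only
  five Atkin-Lehner maps are applied, and every value of \<eta>^2 is followed through an explicit
  word in \<tau> + 1 and -1/\<tau>, so that the roots of unity reduce to integer arithmetic modulo
  12. The single cusp appears only in concrete form: near the centre of its isometric circle each of
  the five maps multiplies the imaginary part by at least 10/9. With integer translations and the
  reflection \<tau> \<mapsto> -cnj \<tau> they bring every point to height at least 1/100 without
  changing the modulus of the function. Both sides of the polynomial identity start with q^3 and
  agree up to q^4. Their difference is O(q^5), its square O(q^10), while (A B)^3 has order 9. This
  one surplus power of q is why two terms of the expansions are enough.\<close>

lemma filterlim_symmetric_intervals:
  "filterlim (\<lambda>n. {- int n..int n}) (finite_subsets_at_top UNIV) sequentially"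
  unfolding filterlim_finite_subsets_at_top
proof (intro allI impI)
  fix X :: "int set"
  assume "finite X \<and> X \<subseteq> UNIV"
  then have fin: "finite X" by simp
  define N where "N = nat (Max (insert 0 (abs ` X)))"
  have "X \<subseteq> {- int n..int n}" if "n \<ge> N" for n
  proof
    fix x assume "x \<in> X"
    then have "\<bar>x\<bar> \<le> Max (insert 0 (abs ` X))" using fin by (intro Max_ge) auto
    with that show "x \<in> {- int n..int n}" unfolding N_def by auto
  qed
  then show "\<forall>\<^sub>F y in sequentially. finite {- int y..int y} \<and> X \<subseteq> {- int y..int y} \<and> {- int y..int y} \<subseteq> UNIV"
    by (auto intro: eventually_sequentiallyI)
qed

lemma symmetric_sum_Suc:
  fixes g :: "int \<Rightarrow> 'a::comm_monoid_add"
  shows "(\<Sum>k\<in>{- int (Suc n)..int (Suc n)}. g k) =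
    (\<Sum>k\<in>{- int n..int n}. g k) + (g (int (Suc n)) + g (- int (Suc n)))"
proof -
  have "{- int (Suc n)..int (Suc n)} =
    insert (int (Suc n)) (insert (- int (Suc n)) {- int n..int n})" by auto
  then show ?thesis by (simp add: algebra_simps)
qed

definition pent :: "complex \<Rightarrow> int \<Rightarrow> complex" where
  "pent q k = (-1) powi k * q powi (k * (3 * k - 1) div 2)"

lemma pent_exponent_ge: "\<bar>k\<bar> \<le> k * (3 * k - 1) div (2::int)"
proof -
  have "2 * \<bar>k\<bar> \<le> k * (3 * k - 1)"
  proof (cases "k \<ge> 1")
    case True
    then have "k * 2 \<le> k * (3 * k - 1)" by (intro mult_left_mono) auto
    then show ?thesis using True by simp
  next
    case False
    then have "(-k) * 0 \<le> (-k) * (- (3 * k + 1))"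
      by (cases "k = 0") (auto simp: mult_nonneg_nonpos2 intro!: mult_nonpos_nonpos)
    then show ?thesis using False by (simp add: algebra_simps)
  qed
  then show ?thesis by linarith
qed

lemma norm_pent_le:
  assumes "norm q < 1"
  shows "norm (pent q k) \<le> norm q ^ nat \<bar>k\<bar>"
proof -
  define m where "m = nat (k * (3 * k - 1) div 2)"
  have m: "k * (3 * k - 1) div 2 = int m" "nat \<bar>k\<bar> \<le> m"
    using pent_exponent_ge[of k] unfolding m_def by auto
  have "norm (pent q k) = norm q ^ m"
    unfolding pent_def m by (simp add: norm_mult norm_power power_int_minus norm_power_int)
  also have "\<dots> \<le> norm q ^ nat \<bar>k\<bar>"
    using m assms by (intro power_decreasing) auto
  finally show ?thesis .
qed

lemma summable_on_int_power_abs: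
  fixes r :: real
  assumes "0 \<le> r" "r < 1"
  shows "(\<lambda>k::int. r ^ nat \<bar>k\<bar>) summable_on UNIV"
proof -
  have geo: "(\<lambda>n::nat. r ^ n) summable_on UNIV"
    using assms by (intro norm_summable_imp_summable_on) auto
  have "(\<lambda>k::int. r ^ nat \<bar>k\<bar>) summable_on range int"
    by (subst summable_on_reindex) (auto simp: o_def geo)
  moreover have "(\<lambda>k::int. r ^ nat \<bar>k\<bar>) summable_on range (\<lambda>n. - int n)"
    by (subst summable_on_reindex) (auto simp: o_def geo inj_on_def)
  moreover have "range int \<union> range (\<lambda>n. - int n) = UNIV"
  proof -
    have "k \<in> range int \<union> range (\<lambda>n. - int n)" for k :: int
      by (cases k rule: int_cases2) auto
    then show ?thesis by blast
  qed
  ultimately show ?thesis by (metis summable_on_union)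
qed

lemma pent_has_sum:
  assumes "norm q < 1"
  shows "(pent q has_sum f_minus q) UNIV"
proof -
  have "(\<lambda>k. norm (pent q k)) summable_on UNIV"
    by (rule summable_on_comparison_test[OF summable_on_int_power_abs[of "norm q"]])
      (use assms norm_pent_le in auto)
  then have "pent q summable_on UNIV" by (rule abs_summable_summable)
  then show ?thesis
    unfolding f_minus_def pent_def[symmetric] by (rule has_sum_infsum)
qed

lemma symmetric_sums_tendsto:
  assumes "(g has_sum S) (UNIV :: int set)"
  shows "(\<lambda>n. \<Sum>k\<in>{- int n..int n}. g k) \<longlonglongrightarrow> S"
  using assms unfolding has_sum_def
  by (rule filterlim_compose[OF _ filterlim_symmetric_intervals])

text \<open>The term with \<open>s = 0\<close> is a partial Euler product. All other terms carry at
  least the n-th power of \<open>q\<close> and disappear in the limit, although the sum over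
  \<open>s\<close> is an exact truncation of the pentagonal series.\<close>

definition shanks :: "complex \<Rightarrow> nat \<Rightarrow> nat \<Rightarrow> complex" where
  "shanks q n s = (-1) ^ s * (\<Prod>j\<in>{s<..n}. 1 - q ^ j) * q ^ (s * n + s * (s + 1) div 2)"

text \<open>Shanks' finite form of Euler's pentagonal number theorem.\<close>

lemma shanks_sum: "(\<Sum>s\<le>n. shanks q n s) = (\<Sum>k\<in>{- int n..int n}. pent q k)"
proof (induction n)
  case 0
  show ?case by (simp add: shanks_def pent_def)
next
  case (Suc n)
  define T :: "nat \<Rightarrow> nat" where "T s = s * (s + 1) div 2" for s
  have T_Suc: "T (Suc s) = T s + Suc s" for s
  proof -
    have "Suc s * (Suc s + 1) = s * (s + 1) + Suc s * 2" by simp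
    then show ?thesis unfolding T_def by (metis div_mult_self1 add.commute zero_neq_numeral)
  qed
  define P where "P s = (\<Prod>j\<in>{s<..n}. 1 - q ^ j)" for s
  \<comment> \<open>Telescoping certificate for the passage from n to n + 1. At \<open>s = 0\<close>
    the truncated \<open>s - 1\<close> would give \<open>P 0\<close>; the value that fits the factor
    1 - q^s found below is 0.\<close>
  define c where "c s = (if s = 0 then 0 else (-1) ^ s * P (s - 1) * q ^ (s * n + T s))" for s
  have step: "shanks q (Suc n) s - shanks q n s = c (Suc s) - c s" if "s \<le> n" for s
  proof -
    have "{s<..Suc n} = insert (Suc n) {s<..n}" using that by auto
    then have 1: "shanks q (Suc n) s = (-1) ^ s * P s * (1 - q ^ Suc n) * q ^ (s * n + T s) * q ^ s"
      unfolding shanks_def P_def T_def by (simp add: power_add algebra_simps)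
    have 2: "shanks q n s = (-1) ^ s * P s * q ^ (s * n + T s)"
      unfolding shanks_def P_def T_def by simp
    have 3: "c (Suc s) = - ((-1) ^ s * P s * q ^ (s * n + T s) * (q ^ Suc n * q ^ s))"
      unfolding c_def T_Suc by (simp add: power_add algebra_simps)
    have 4: "c s = (-1) ^ s * P s * q ^ (s * n + T s) * (1 - q ^ s)"
    proof (cases s)
      case (Suc r)
      have "{r<..n} = insert (Suc r) {Suc r<..n}" using that Suc by auto
      then show ?thesis unfolding c_def P_def Suc by (simp add: algebra_simps)
    qed (simp add: c_def)
    show ?thesis unfolding 1 2 3 4 by (simp add: algebra_simps)
  qed
  have "(\<Sum>s\<le>n. shanks q (Suc n) s) - (\<Sum>s\<le>n. shanks q n s) = (\<Sum>s\<le>n. c (Suc s) - c s)"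
    using step by (simp flip: sum_subtractf)
  also have "\<dots> = c (Suc n) - c 0" 
    by (simp only: lessThan_Suc_atMost[symmetric] sum_lessThan_telescope)
  finally have *: "(\<Sum>s\<le>n. shanks q (Suc n) s) = (\<Sum>s\<le>n. shanks q n s) + c (Suc n)"
    by (simp add: c_def algebra_simps)
  have "2 * T s = s * (s + 1)" for s unfolding T_def by simp
  from this[THEN arg_cong[of _ _ int]]
  have two_T: "2 * int (T s) = int s * (int s + 1)" for s by (simp add: algebra_simps)
  have "int (Suc n) * (3 * int (Suc n) - 1) = 2 * int (Suc n * n + T (Suc n))"
    using two_T[of "Suc n"] by (simp add: algebra_simps)
  then have e1: "int (Suc n) * (3 * int (Suc n) - 1) div 2 = int (Suc n * n + T (Suc n))" by simp
  have "- int (Suc n) * (3 * (- int (Suc n)) - 1) = 2 * int (Suc n * Suc n + T (Suc n))"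
    using two_T[of "Suc n"] by (simp add: algebra_simps)
  then have e2: "- int (Suc n) * (3 * (- int (Suc n)) - 1) div 2 = int (Suc n * Suc n + T (Suc n))" by simp
  have sgn: "(-1) powi (- int m) = (-1 :: complex) ^ m" for m
    by (simp add: power_int_minus flip: power_inverse)
  \<comment> \<open>The two new pentagonal terms have different sources: index n + 1 is the end of
    the telescope, index -(n + 1) is the additional summand \<open>s = n + 1\<close>.\<close>
  have "c (Suc n) = pent q (int (Suc n))"
    unfolding pent_def e1 c_def P_def power_int_of_nat by simp
  moreover have "shanks q (Suc n) (Suc n) = pent q (- int (Suc n))"
    unfolding pent_def e2 sgn power_int_of_nat unfolding shanks_def T_def by simp
  ultimately show ?case
    unfolding symmetric_sum_Suc using * Suc.IH by (simp add: algebra_simps)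
qed

lemma convergent_prod_euler:
  assumes "norm (q::complex) < 1"
  shows "convergent_prod (\<lambda>n. 1 - q ^ Suc n)"
proof (rule abs_convergent_prod_imp_convergent_prod)
  have "summable (\<lambda>n. norm q ^ Suc n)"
    using assms by (simp add: summable_mult)
  then show "abs_convergent_prod (\<lambda>n. 1 - q ^ Suc n)"
    by (subst abs_convergent_prod_conv_summable) (simp add: norm_power norm_mult)
qed

text \<open>The product is at most the exponential of a geometric series, and the exponent of
  \<open>q\<close> is at least n once \<open>s\<close> is positive. The bound does not depend on
  \<open>s\<close>, so n such terms still add up to something that tends to 0.\<close>

lemma norm_shanks_le:
  assumes "norm q < 1" "s \<ge> 1"
  shows "norm (shanks q n s) \<le> exp (1 / (1 - norm q)) * norm q ^ n"
proof -
  define r where "r = norm q"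
  have r: "0 \<le> r" "r < 1" using assms r_def by auto
  have "norm (\<Prod>j\<in>{s<..n}. 1 - q ^ j) \<le> (\<Prod>j\<in>{s<..n}. exp (r ^ j))"
    unfolding prod_norm[symmetric]
  proof (intro prod_mono conjI)
    fix j
    have "norm (1 - q ^ j) \<le> 1 + r ^ j"
      using norm_triangle_ineq4[of 1 "q ^ j"] by (simp add: norm_power r_def)
    also have "\<dots> \<le> exp (r ^ j)" by (rule exp_ge_add_one_self)
    finally show "norm (1 - q ^ j) \<le> exp (r ^ j)" .
  qed simp
  also have "\<dots> = exp (\<Sum>j\<in>{s<..n}. r ^ j)" by (simp add: exp_sum)
  also have "(\<Sum>j\<in>{s<..n}. r ^ j) \<le> (\<Sum>j. r ^ j)"
    using r by (intro sum_le_suminf summable_geometric) auto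
  also have "\<dots> = 1 / (1 - r)" using r by (intro suminf_geometric) auto
  finally have 1: "norm (\<Prod>j\<in>{s<..n}. 1 - q ^ j) \<le> exp (1 / (1 - r))" by simp
  have "n \<le> s * n + s * (s + 1) div 2" using assms by (simp add: trans_le_add1)
  then have 2: "r ^ (s * n + s * (s + 1) div 2) \<le> r ^ n"
    using r by (intro power_decreasing) auto
  have "norm (shanks q n s) =
      norm (\<Prod>j\<in>{s<..n}. 1 - q ^ j) * r ^ (s * n + s * (s + 1) div 2)"
    unfolding shanks_def norm_mult norm_power r_def by simp
  also have "\<dots> \<le> exp (1 / (1 - r)) * r ^ n"
    using 1 2 r by (intro mult_mono) auto
  finally show ?thesis unfolding r_def .
qed

theorem f_minus_eq_prodinf:
  assumes "norm q < 1"
  shows "f_minus q = (\<Prod>n. 1 - q ^ Suc n)"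
proof (rule LIMSEQ_unique)
  define C where "C = exp (1 / (1 - norm q))"
  show "(\<lambda>n. \<Sum>k\<in>{- int n..int n}. pent q k) \<longlonglongrightarrow> f_minus q"
    by (rule symmetric_sums_tendsto[OF pent_has_sum[OF assms]])
  have split: "(\<Sum>k\<in>{- int n..int n}. pent q k)
      = shanks q n 0 + (\<Sum>s\<in>{1..n}. shanks q n s)" for n
    unfolding shanks_sum[symmetric] by (simp add: atMost_atLeast0 sum.atLeast_Suc_atMost)
  have "shanks q n 0 = (\<Prod>i<n. 1 - q ^ Suc i)" for n
  proof -
    have "{0<..n} = Suc ` {..<n}" by (auto simp: image_iff Suc_le_eq gr0_conv_Suc)
    then show ?thesis unfolding shanks_def by (simp add: prod.reindex)
  qed
  moreover have "(\<lambda>n. \<Prod>i<n. 1 - q ^ Suc i) \<longlonglongrightarrow> (\<Prod>n. 1 - q ^ Suc n)"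
    using convergent_prod_LIMSEQ[OF convergent_prod_euler[OF assms]]
    by (subst filterlim_sequentially_Suc[symmetric]) (simp only: lessThan_Suc_atMost)
  ultimately have 1: "(\<lambda>n. shanks q n 0) \<longlonglongrightarrow> (\<Prod>n. 1 - q ^ Suc n)" by simp
  have 2: "(\<lambda>n. \<Sum>s\<in>{1..n}. shanks q n s) \<longlonglongrightarrow> 0"
  proof (rule Lim_null_comparison)
    show "\<forall>\<^sub>F n in sequentially. norm (\<Sum>s\<in>{1..n}. shanks q n s) \<le> C * (of_nat n * norm q ^ n)"
    proof (intro always_eventually allI)
      fix n
      have "norm (\<Sum>s\<in>{1..n}. shanks q n s) \<le> (\<Sum>s\<in>{1..n}. C * norm q ^ n)"
        unfolding C_def using assms by (intro sum_norm_le norm_shanks_le) auto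
      then show "norm (\<Sum>s\<in>{1..n}. shanks q n s) \<le> C * (of_nat n * norm q ^ n)"
        by (simp add: algebra_simps)
    qed
    show "(\<lambda>n. C * (of_nat n * norm q ^ n)) \<longlonglongrightarrow> 0"
      using assms by (intro tendsto_mult_right_zero powser_times_n_limit_0) auto
  qed
  show "(\<lambda>n. \<Sum>k\<in>{- int n..int n}. pent q k) \<longlonglongrightarrow> (\<Prod>n. 1 - q ^ Suc n)"
    unfolding split using tendsto_add[OF 1 2] by simp
qed

lemma f_minus_nonzero:
  assumes "norm q < 1"
  shows "f_minus q \<noteq> 0"
proof -
  have "1 - q ^ Suc n \<noteq> 0" for n
  proof
    assume "1 - q ^ Suc n = 0"
    then have "q ^ Suc n = 1" by simp
    then have "norm q ^ Suc n = 1" by (metis norm_one norm_power)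
    moreover have "norm q ^ Suc n < 1" using assms by (metis norm_ge_zero power_less_one_iff zero_less_Suc)
    ultimately show False by simp
  qed
  then show ?thesis
    unfolding f_minus_eq_prodinf[OF assms]
    by (intro prodinf_nonzero convergent_prod_euler assms)
qed

lemma f_minus_cnj: "f_minus (cnj q) = cnj (f_minus q)"
proof -
  have "pent (cnj q) k = cnj (pent q k)" for k
    unfolding pent_def power_int_def by simp
  then show ?thesis
    unfolding f_minus_def pent_def[symmetric] by simp
qed

lemma f_minus_holomorphic: "f_minus holomorphic_on ball 0 1"
proof (rule holomorphic_uniform_sequence)
  show "(\<lambda>q. \<Sum>k\<in>{- int n..int n}. pent q k) holomorphic_on ball 0 1" for n
  proof -
    have "pent q k = (-1) powi k * q ^ nat (k * (3 * k - 1) div 2)" for q k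
      using pent_exponent_ge[of k] by (simp add: pent_def power_int_def)
    then show ?thesis by (auto intro!: holomorphic_intros)
  qed
  fix q :: complex assume "q \<in> ball 0 1"
  then have q: "norm q < 1" by simp
  \<comment> \<open>Half the distance to the unit circle, so that r = (1 + |q|)/2 < 1 dominates the
    closed disc and gives one geometric majorant there.\<close>
  define d where "d = (1 - norm q) / 2"
  have "norm z \<le> norm q + d" if "z \<in> cball q d" for z
    using that norm_triangle_ineq2[of z q] by (simp add: dist_norm norm_minus_commute)
  moreover define r where "r = norm q + d"
  ultimately have rz: "norm z \<le> r" if "z \<in> cball q d" for z using that by simp
  have r: "0 \<le> r" "r < 1" "0 < d" using q by (auto simp: r_def d_def field_simps)
  have "uniform_limit (cball q d) (\<lambda>X z. \<Sum>k\<in>X. pent z k) (\<lambda>z. infsum (pent z) UNIV)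
      (finite_subsets_at_top UNIV)"
  proof (rule Weierstrass_m_test_general)
    show "norm (pent z k) \<le> r ^ nat \<bar>k\<bar>" if "z \<in> cball q d" for k z
    proof -
      have "norm (pent z k) \<le> norm z ^ nat \<bar>k\<bar>" using rz[OF that] r by (intro norm_pent_le) auto
      also have "\<dots> \<le> r ^ nat \<bar>k\<bar>" using rz[OF that] by (intro power_mono) auto
      finally show ?thesis .
    qed
    show "(\<lambda>k::int. r ^ nat \<bar>k\<bar>) summable_on UNIV" using r by (intro summable_on_int_power_abs)
  qed
  then have "uniform_limit (cball q d) (\<lambda>X z. \<Sum>k\<in>X. pent z k) f_minus (finite_subsets_at_top UNIV)"
    unfolding f_minus_def pent_def by simp
  then have "uniform_limit (cball q d) (\<lambda>n z. \<Sum>k\<in>{- int n..int n}. pent z k) f_minus sequentially"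
    by (rule filterlim_compose[OF _ filterlim_symmetric_intervals])
  moreover have "cball q d \<subseteq> ball 0 1"
  proof
    fix z assume "z \<in> cball q d"
    from rz[OF this] r show "z \<in> ball 0 1" by simp
  qed
  ultimately show "\<exists>d. 0 < d \<and> cball q d \<subseteq> ball 0 1 \<and>
      uniform_limit (cball q d) (\<lambda>n z. \<Sum>k\<in>{- int n..int n}. pent z k) f_minus sequentially"
    using r by blast
qed simp

lemma f_minus_0: "f_minus 0 = 1"
  by (simp add: f_minus_eq_prodinf)

section \<open>Poisson summation\<close>

lemma periodic_add_int:
  fixes d :: "real \<Rightarrow> 'a"
  assumes "\<And>x. d (x + 1) = d x"
  shows "d (x + of_int n) = d x"
proof (induction n rule: int_induct[of _ 0])
  case (step1 i)
  then show ?case using assms[of "x + of_int i"] by (simp add: add.assoc)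
next
  case (step2 i)
  then show ?case using assms[of "x + of_int (i - 1)"] by (simp add: add.assoc)
qed simp

lemma periodic_lift_to_circle:
  fixes d :: "real \<Rightarrow> complex"
  assumes cont: "continuous_on UNIV d" and per: "\<And>x. d (x + 1) = d x"
  obtains g where "continuous_on (sphere 0 1) g" "\<And>x. g (cis (2 * pi * x)) = d x"
proof
  define g where "g w = d (Arg w / (2 * pi))" for w
  have d_cis: "d x = d y" if "cis (2 * pi * x) = cis (2 * pi * y)" for x y
  proof -
    have "sin (2 * pi * x) = sin (2 * pi * y) \<and> cos (2 * pi * x) = cos (2 * pi * y)"
      using that by (metis cis.sel)
    then obtain n :: int where "2 * pi * x = 2 * pi * y + 2 * pi * n"
      unfolding sin_cos_eq_iff by auto
    then have "2 * pi * x = 2 * pi * (y + n)" by (simp add: algebra_simps)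
    then have "x = y + n" by simp
    then show ?thesis using periodic_add_int[of d y n] per by simp
  qed
  have cis_Arg': "cis (Arg w) = w" if "norm w = 1" for w
    using that cis_Arg[of w] by (cases "w = 0") (auto simp: sgn_eq)
  show "g (cis (2 * pi * x)) = d x" for x
    unfolding g_def by (rule d_cis) (simp add: cis_Arg')
  show "continuous_on (sphere 0 1) g"
    unfolding continuous_on_eq_continuous_within
  proof
    fix w0 :: complex assume "w0 \<in> sphere 0 1"
    then have w0: "norm w0 = 1" "w0 \<noteq> 0" by auto
    \<comment> \<open>\<open>Arg\<close> jumps on the negative axis. Replacing it near
      \<open>w0\<close> by the argument of \<open>w0\<close> plus that of \<open>w / w0\<close>
      changes it on the circle by a multiple of 2 pi only, which \<open>d\<close> does not see, and
      the new expression is continuous at \<open>w0\<close>.\<close>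
    define h where "h w = d (Arg w0 / (2 * pi) + Im (Ln (w / w0)) / (2 * pi))" for w
    have gh: "g w = h w" if "w \<in> sphere 0 1" for w
    proof -
      have w: "norm w = 1" "w \<noteq> 0" using that by auto
      have "Im (Ln (w / w0)) = Arg (w / w0)" using w w0 by (simp add: Arg_eq_Im_Ln)
      then have "2 * pi * (Arg w0 / (2 * pi) + Im (Ln (w / w0)) / (2 * pi)) = Arg w0 + Arg (w / w0)"
        by (simp add: field_simps)
      then have "cis (2 * pi * (Arg w0 / (2 * pi) + Im (Ln (w / w0)) / (2 * pi)))
          = cis (Arg w0) * cis (Arg (w / w0))"
        by (simp only: cis_mult)
      also have "\<dots> = w" using w w0 by (simp add: cis_Arg' norm_divide)
      finally show ?thesis
        unfolding g_def h_def using w by (intro d_cis) (simp add: cis_Arg')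
    qed
    have conth: "isCont h w0"
      unfolding h_def
    proof (rule isCont_o2[where g = d])
      show "isCont (\<lambda>w. Arg w0 / (2 * pi) + Im (Ln (w / w0)) / (2 * pi)) w0"
        using w0 by (intro continuous_intros isCont_Ln') (auto simp: complex_nonpos_Reals_iff)
      show "isCont d (Arg w0 / (2 * pi) + Im (Ln (w0 / w0)) / (2 * pi))"
        using cont by (simp add: continuous_on_eq_continuous_at del: right_inverse)
    qed
    show "continuous (at w0 within sphere 0 1) g"
      by (rule continuous_transform_within
          [OF continuous_at_imp_continuous_at_within[OF conth] zero_less_one \<open>w0 \<in> sphere 0 1\<close>])
        (simp only: gh)
  qed
qed

text \<open>A predicate of its own because it is stable under multiplication by polynomials in the
  point of the circle. Continuity is included so that all these integrals exist.\<close>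

definition zero_coeffs :: "(real \<Rightarrow> complex) \<Rightarrow> bool" where
  "zero_coeffs d \<longleftrightarrow> continuous_on UNIV d \<and>
    (\<forall>k::int. integral {0..1} (\<lambda>x. d x * cis (2 * pi * k * x)) = 0)"

lemma zero_coeffs_linear:
  assumes "zero_coeffs d" "zero_coeffs e"
  shows "zero_coeffs (\<lambda>x. a * d x + b * e x)"
  unfolding zero_coeffs_def
proof (intro conjI allI)
  show "continuous_on UNIV (\<lambda>x. a * d x + b * e x)"
    using assms by (auto simp: zero_coeffs_def intro!: continuous_intros)
  fix k :: int
  have int: "(\<lambda>x. d x * cis (2 * pi * k * x)) integrable_on {0..1}"
    "(\<lambda>x. e x * cis (2 * pi * k * x)) integrable_on {0..1}"
    using assms by (auto simp: zero_coeffs_def cis_conv_exp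
      intro!: integrable_continuous_real continuous_intros intro: continuous_on_subset)
  have "integral {0..1} (\<lambda>x. (a * d x + b * e x) * cis (2 * pi * k * x)) =
      integral {0..1} (\<lambda>x. a * (d x * cis (2 * pi * k * x)) + b * (e x * cis (2 * pi * k * x)))"
    by (simp add: algebra_simps)
  also have "\<dots> = a * integral {0..1} (\<lambda>x. d x * cis (2 * pi * k * x))
      + b * integral {0..1} (\<lambda>x. e x * cis (2 * pi * k * x))"
    using int by (subst Henstock_Kurzweil_Integration.integral_add)
      (auto intro: integrable_on_mult_right)
  finally show "integral {0..1} (\<lambda>x. (a * d x + b * e x) * cis (2 * pi * k * x)) = 0"
    using assms by (simp add: zero_coeffs_def)
qed

lemma zero_coeffs_cis:
  assumes "zero_coeffs d"
  shows "zero_coeffs (\<lambda>x. cis (2 * pi * of_int m * x) * d x)"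
  unfolding zero_coeffs_def
proof (intro conjI allI)
  show "continuous_on UNIV (\<lambda>x. cis (2 * pi * of_int m * x) * d x)"
    using assms by (auto simp: zero_coeffs_def cis_conv_exp intro!: continuous_intros)
  fix k :: int
  have "cis (2 * pi * of_int m * x) * d x * cis (2 * pi * k * x)
      = d x * cis (2 * pi * of_int (m + k) * x)" for x
    by (simp add: algebra_simps cis_mult)
  then show "integral {0..1} (\<lambda>x. cis (2 * pi * of_int m * x) * d x * cis (2 * pi * k * x)) = 0"
    using assms by (simp only: zero_coeffs_def)
qed

text \<open>A real linear form on the plane is a combination of w and \<open>cnj w\<close>, and on
  the circle multiplication by either merely shifts the Fourier coefficients. The induction keeps
  \<open>d\<close> arbitrary, so for a product of polynomials the hypothesis is applied twice in
  succession.\<close>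

lemma zero_coeffs_mult_real_polynomial:
  fixes p :: "complex \<Rightarrow> real"
  assumes "real_polynomial_function p" "zero_coeffs d"
  shows "zero_coeffs (\<lambda>x. of_real (p (cis (2 * pi * x))) * d x)"
  using assms
proof (induction arbitrary: d rule: real_polynomial_function.induct)
  case (linear f)
  \<comment> \<open>Chosen such that \<open>f w\<close> is the real part of
    \<open>\<beta> * w\<close>.\<close>
  define \<beta> where "\<beta> = Complex (f 1) (- f \<i>)"
  have f: "f w = Re w * f 1 + Im w * f \<i>" for w
  proof -
    interpret bounded_linear f by (rule linear)
    have "f w = f (Re w *\<^sub>R 1 + Im w *\<^sub>R \<i>)"
      by (rule arg_cong[of _ _ f]) (simp add: complex_eq_iff)
    also have "\<dots> = Re w * f 1 + Im w * f \<i>" by (simp only: add scaleR real_scaleR_def)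
    finally show ?thesis .
  qed
  have f': "of_real (f w) = \<beta> / 2 * w + cnj \<beta> / 2 * cnj w" for w
    by (subst f) (simp add: complex_eq_iff \<beta>_def diff_divide_distrib algebra_simps)
  have "of_real (f (cis (2 * pi * x))) * d x =
      \<beta> / 2 * (cis (2 * pi * of_int 1 * x) * d x)
      + cnj \<beta> / 2 * (cis (2 * pi * of_int (-1) * x) * d x)" for x
    unfolding f' by (simp add: cis_cnj distrib_right mult.assoc)
  then show ?case
    by (simp only:) (intro zero_coeffs_linear zero_coeffs_cis linear.prems)
next
  case (const c)
  show ?case using zero_coeffs_linear[OF const const, of "of_real c" 0] by simp
next
  case (add f g)
  show ?case using zero_coeffs_linear[OF add.IH(1)[OF add.prems] add.IH(2)[OF add.prems], of 1 1]
    by (simp add: algebra_simps)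
next
  case (mult f g)
  show ?case using mult.IH(1)[OF mult.IH(2)[OF mult.prems]] by (simp add: algebra_simps)
qed

lemma zero_coeffs_mult_polynomial:
  fixes p :: "complex \<Rightarrow> complex"
  assumes "polynomial_function p" "zero_coeffs d"
  shows "zero_coeffs (\<lambda>x. p (cis (2 * pi * x)) * d x)"
proof -
  have "real_polynomial_function (Re \<circ> p)" "real_polynomial_function (Im \<circ> p)"
    using assms(1) unfolding polynomial_function_def
    by (auto intro: bounded_linear_Re bounded_linear_Im)
  then have "zero_coeffs (\<lambda>x. 1 * (of_real (Re (p (cis (2 * pi * x)))) * d x)
      + \<i> * (of_real (Im (p (cis (2 * pi * x)))) * d x))"
    using zero_coeffs_mult_real_polynomial[OF _ assms(2)]
    by (intro zero_coeffs_linear) (auto simp: o_def)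
  moreover have "1 * (of_real (Re w) * z) + \<i> * (of_real (Im w) * z) = w * z" for w z :: complex
    by (simp add: complex_eq_iff)
  ultimately show ?thesis by simp
qed

text \<open>On the circle \<open>cnj d\<close> is a uniform limit of polynomials p, and the integral
  of p d vanishes. Hence the integral of |d|^2 equals that of (cnj d - p) d, which is arbitrarily
  small.\<close>

theorem fourier_uniqueness:
  assumes zero: "zero_coeffs d" and per: "\<And>x. d (x + 1) = d x" and x: "x \<in> {0..1}"
  shows "d x = 0"
proof -
  have cont: "continuous_on UNIV d" using zero by (simp add: zero_coeffs_def)
  then have cont': "continuous_on {0..1} d" by (rule continuous_on_subset) auto
  obtain g where g: "continuous_on (sphere 0 1) g" "\<And>x. g (cis (2 * pi * x)) = cnj (d x)"
    by (rule periodic_lift_to_circle[of "\<lambda>x. cnj (d x)"])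
      (auto simp: per intro!: continuous_intros cont)
  define M where "M = integral {0..1} (\<lambda>x. norm (d x))"
  define I where "I = integral {0..1} (\<lambda>x. cnj (d x) * d x)"
  have "norm I \<le> 0 + \<epsilon>" if "\<epsilon> > 0" for \<epsilon>
  proof -
    have M: "0 \<le> M" unfolding M_def
      by (intro Henstock_Kurzweil_Integration.integral_nonneg integrable_continuous_real continuous_intros cont') auto
    \<comment> \<open>The summand 1 keeps the quotient meaningful if \<open>M = 0\<close>.\<close>
    define \<delta> where "\<delta> = \<epsilon> / (M + 1)"
    have \<delta>: "0 < \<delta>" using M that by (simp add: \<delta>_def)
    obtain p where p: "polynomial_function p" "\<And>w. w \<in> sphere 0 1 \<Longrightarrow> norm (g w - p w) < \<delta>"
      using Stone_Weierstrass_polynomial_function[OF compact_sphere g(1) \<delta>] by blast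
    let ?e = "\<lambda>x. p (cis (2 * pi * x)) * d x"
    have z: "zero_coeffs ?e" by (rule zero_coeffs_mult_polynomial[OF p(1) zero])
    then have "\<forall>k::int. integral {0..1} (\<lambda>x. ?e x * cis (2 * pi * k * x)) = 0"
      unfolding zero_coeffs_def by blast
    from spec[OF this, of 0] have int0: "integral {0..1} ?e = 0" by simp
    have cont_e: "continuous_on {0..1} ?e"
      using z unfolding zero_coeffs_def by (auto intro: continuous_on_subset)
    have "I = I - integral {0..1} ?e" using int0 by simp
    also have "\<dots> = integral {0..1} (\<lambda>x. cnj (d x) * d x - ?e x)"
      unfolding I_def
      by (intro Henstock_Kurzweil_Integration.integral_diff[symmetric] integrable_continuous_real
        continuous_intros cont' cont_e)
    also have "norm \<dots> \<le> integral {0..1} (\<lambda>x. \<delta> * norm (d x))"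
    proof (rule integral_norm_bound_integral)
      fix x :: real
      have "norm (cnj (d x) * d x - ?e x) = norm (g (cis (2 * pi * x)) - p (cis (2 * pi * x))) * norm (d x)"
        by (simp add: g(2) norm_mult flip: left_diff_distrib)
      also have "\<dots> \<le> \<delta> * norm (d x)"
        using p(2)[of "cis (2 * pi * x)"] by (intro mult_right_mono) auto
      finally show "norm (cnj (d x) * d x - ?e x) \<le> \<delta> * norm (d x)" .
    qed (intro integrable_continuous_real continuous_intros cont' cont_e)+
    also have "\<dots> = \<delta> * M" by (simp add: M_def)
    also have "\<dots> \<le> \<epsilon>" using M that by (simp add: \<delta>_def field_simps)
    finally show ?thesis by simp
  qed
  then have "I = 0" using field_le_epsilon[of "norm I" 0] by simp
  have "cnj z * z = of_real ((norm z)\<^sup>2)" for z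
    by (metis complex_norm_square mult.commute of_real_power)
  then have "I = integral {0..1} (\<lambda>x. of_real ((norm (d x))\<^sup>2))"
    unfolding I_def by (simp only:)
  also have "\<dots> = of_real (integral {0..1} (\<lambda>x. (norm (d x))\<^sup>2))"
    by (intro integral_unique has_integral_of_real integrable_integral
      integrable_continuous_real continuous_intros cont')
  finally have "integral {0..1} (\<lambda>x. (norm (d x))\<^sup>2) = 0" using \<open>I = 0\<close> by simp
  then have "\<forall>x\<in>{0..1}. (norm (d x))\<^sup>2 = 0"
    by (subst (asm) integral_eq_0_iff) (auto intro!: continuous_intros cont')
  then show ?thesis using x by simp
qed

text \<open>Both sides are continuous, have period 1 and have the same Fourier coefficients: the
  left one by unfolding unit intervals into the whole line, the right one by orthogonality. The
  majorant may depend on \<open>M\<close>, since the translates of a decaying function can be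
  dominated uniformly only for bounded \<open>x\<close>.\<close>

theorem poisson_summation:
  fixes F :: "real \<Rightarrow> complex" and Fhat :: "int \<Rightarrow> complex"
  assumes cont: "continuous_on UNIV F"
    and bound: "\<And>M::real. \<exists>b. b summable_on UNIV \<and> (\<forall>x\<in>{-M..M}. \<forall>n::int. norm (F (x + of_int n)) \<le> b n)"
    and integrable: "integrable lborel F"
    and hat: "\<And>k::int. Fhat k = (\<integral>y. F y * cis (- 2 * pi * k * y) \<partial>lborel)"
    and hat_summable: "(\<lambda>k::int. norm (Fhat k)) summable_on UNIV"
    and x: "x \<in> {0..1}"
  shows "(\<Sum>\<^sub>\<infinity>n::int. F (x + of_int n)) = (\<Sum>\<^sub>\<infinity>k::int. Fhat k * cis (2 * pi * k * x))"
proof -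
  define L where "L x = (\<Sum>\<^sub>\<infinity>n::int. F (x + of_int n))" for x
  define R where "R x = (\<Sum>\<^sub>\<infinity>k::int. Fhat k * cis (2 * pi * k * x))" for x
  have unif_L: "uniform_limit {-M..M} (\<lambda>N x. \<Sum>n\<in>{- int N..int N}. F (x + of_int n)) L sequentially" for M :: real
  proof -
    from bound[of M] obtain b where b: "b summable_on UNIV"
      "\<forall>x\<in>{-M..M}. \<forall>n::int. norm (F (x + of_int n)) \<le> b n" by (elim exE conjE)
    have "uniform_limit {-M..M} (\<lambda>X x. \<Sum>n\<in>X. F (x + of_int n)) L (finite_subsets_at_top UNIV)"
      unfolding L_def by (rule Weierstrass_m_test_general[OF _ b(1)]) (use b(2) in auto)
    then show ?thesis by (rule filterlim_compose[OF _ filterlim_symmetric_intervals])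
  qed
  have unif_R: "uniform_limit UNIV (\<lambda>N x. \<Sum>k\<in>{- int N..int N}. Fhat k * cis (2 * pi * k * x)) R sequentially"
  proof -
    have "uniform_limit UNIV (\<lambda>X x. \<Sum>k\<in>X. Fhat k * cis (2 * pi * of_int k * x)) R (finite_subsets_at_top UNIV)"
      unfolding R_def by (rule Weierstrass_m_test_general[OF _ hat_summable]) (auto simp: norm_mult)
    then show ?thesis by (rule filterlim_compose[OF _ filterlim_symmetric_intervals])
  qed
  have contF: "continuous_on A (\<lambda>x. F (x + of_int n))" for A n
    by (intro continuous_on_compose2[OF cont] continuous_intros) auto
  have cont_cis: "continuous_on A (\<lambda>x. cis (a * x))" for a A
    by (auto simp: cis_conv_exp intro!: continuous_intros)
  have contL: "continuous_on UNIV L"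
  proof -
    have "isCont L x" for x
    proof -
      have "continuous_on {- (\<bar>x\<bar> + 1)..\<bar>x\<bar> + 1} L"
        by (rule uniform_limit_theorem[OF _ unif_L])
          (auto intro!: always_eventually continuous_intros contF)
      then show ?thesis
        by (rule continuous_on_interior) (auto simp: interior_atLeastAtMost_real)
    qed
    then show ?thesis by (simp add: continuous_on_eq_continuous_at)
  qed
  have contR: "continuous_on UNIV R"
    by (rule uniform_limit_theorem[OF _ unif_R])
      (auto intro!: always_eventually continuous_intros cont_cis)
  have perL: "L (x + 1) = L x" for x
  proof -
    have "bij_betw (\<lambda>n::int. n + 1) UNIV UNIV"
      by (rule bij_betwI[of _ _ _ "\<lambda>n. n - 1"]) auto
    from infsum_reindex_bij_betw[OF this, of "\<lambda>n. F (x + of_int n)"]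
    show ?thesis unfolding L_def by (simp add: algebra_simps)
  qed
  have perR: "R (x + 1) = R x" for x
  proof -
    have "cis (2 * pi * of_int k * (x + 1)) = cis (2 * pi * of_int k * x)" for k
    proof -
      have "cis (2 * pi * of_int k * (x + 1)) = cis (2 * pi * of_int k * x) * cis (2 * pi * of_int k)"
        by (simp add: cis_mult algebra_simps)
      then show ?thesis by simp
    qed
    then show ?thesis unfolding R_def by simp
  qed
  \<comment> \<open>The test function has frequency +k whereas \<open>Fhat k\<close> integrates
    against frequency -k, hence the sign in the result.\<close>
  have coeffL: "integral {0..1} (\<lambda>x. L x * cis (2 * pi * k * x)) = Fhat (- k)" for k :: int
  proof -
    define G where "G y = F y * cis (2 * pi * k * y)" for y
    have contG: "continuous_on A G" for A
      unfolding G_def by (intro continuous_intros continuous_on_subset[OF cont] cont_cis) auto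
    have "integrable lborel G"
    proof (rule Bochner_Integration.integrable_bound[OF integrable])
      show "G \<in> borel_measurable lborel"
        using borel_measurable_continuous_onI[OF contG] by simp
    qed (simp add: G_def norm_mult)
    have unif: "uniform_limit {0..1::real} (\<lambda>N x. (\<Sum>n\<in>{- int N..int N}. F (x + of_int n)) * cis (2 * pi * k * x))
        (\<lambda>x. L x * cis (2 * pi * k * x)) sequentially"
    proof (rule uniform_lim_mult)
      show "uniform_limit {0..1::real} (\<lambda>N x. \<Sum>n\<in>{- int N..int N}. F (x + of_int n)) L sequentially"
        using unif_L[of 1] by (rule uniform_limit_on_subset) auto
      have "continuous_on {0..1} L" using contL by (rule continuous_on_subset) auto
      then show "bounded (L ` {0..1})"
        by (intro compact_imp_bounded compact_continuous_image) auto
      show "bounded ((\<lambda>x. cis (2 * pi * k * x)) ` {0..1})"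
        by (auto simp: bounded_iff intro!: exI[of _ 1])
    qed (rule uniform_limit_const)
    obtain I J where IJ:
      "\<And>N. ((\<lambda>x. (\<Sum>n\<in>{- int N..int N}. F (x + of_int n)) * cis (2 * pi * k * x)) has_integral I N) {0..1}"
      "((\<lambda>x. L x * cis (2 * pi * k * x)) has_integral J) {0..1}" "I \<longlonglongrightarrow> J"
      by (rule uniform_limit_integral[OF unif]) (auto intro!: continuous_intros contF cont_cis)
    have G_shift: "(\<Sum>n\<in>{- int N..int N}. F (x + of_int n)) * cis (2 * pi * k * x)
        = (\<Sum>n\<in>{- int N..int N}. G (of_int n + x))" for x N
    proof -
      have "cis (2 * pi * k * (of_int n + x)) = cis (2 * pi * of_int (k * n)) * cis (2 * pi * k * x)" for n
        by (simp add: cis_mult algebra_simps)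
      moreover have "cis (2 * pi * of_int (k * n)) = 1" for n by (rule cis_multiple_2pi) simp
      ultimately show ?thesis unfolding G_def by (simp add: sum_distrib_right add.commute)
    qed
    \<comment> \<open>The translates of [0, 1] by -N, ..., N fill [-N, N + 1]; the interval is not
      symmetric.\<close>
    have "((\<lambda>x. \<Sum>n\<in>{- int N..int N}. G (of_int n + x)) has_integral
        integral {- real N..real N + 1} G) {0..1}" for N
    proof (induction N)
      case 0
      show ?case using integrable_integral[OF integrable_continuous_real[OF contG]] by simp
    next
      case (Suc N)
      have sh: "((\<lambda>x. G (of_int n + x)) has_integral integral {of_int n..of_int n + 1} G) {0..1}" for n
      proof -
        have "((G \<circ> (+) (of_int n)) has_integral integral {0 + of_int n..1 + of_int n} G) {0..1}"
          unfolding has_integral_shift_Icc_real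
          by (intro integrable_integral integrable_continuous_real contG)
        then show ?thesis by (simp add: o_def add.commute)
      qed
      have c1: "integral {- real (Suc N)..- real N} G + integral {- real N..real N + 1} G
          = integral {- real (Suc N)..real N + 1} G"
        by (intro Henstock_Kurzweil_Integration.integral_combine integrable_continuous_real contG) auto
      have c2: "integral {- real (Suc N)..real N + 1} G + integral {real N + 1..real (Suc N) + 1} G
          = integral {- real (Suc N)..real (Suc N) + 1} G"
        by (intro Henstock_Kurzweil_Integration.integral_combine integrable_continuous_real contG) auto
      have "((\<lambda>x. G (of_int (int (Suc N)) + x)) has_integral
          integral {real N + 1..real (Suc N) + 1} G) {0..1}"
        using sh[of "int (Suc N)"] by (simp add: algebra_simps)
      moreover have "((\<lambda>x. G (of_int (- int (Suc N)) + x)) has_integral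
          integral {- real (Suc N)..- real N} G) {0..1}"
        using sh[of "- int (Suc N)"] by (simp add: algebra_simps)
      moreover have "integral {- real (Suc N)..real (Suc N) + 1} G =
          integral {- real N..real N + 1} G
          + (integral {real N + 1..real (Suc N) + 1} G + integral {- real (Suc N)..- real N} G)"
        unfolding c2[symmetric] c1[symmetric] by (simp add: algebra_simps)
      ultimately show ?case
        unfolding symmetric_sum_Suc by (simp only:) (intro has_integral_add Suc.IH)
    qed
    then have "I = (\<lambda>N. integral {- real N..real N + 1} G)"
      using IJ(1) unfolding G_shift by (blast intro: has_integral_unique)
    moreover have "(\<lambda>N. integral {- real N..real N + 1} G) \<longlonglongrightarrow> (\<integral>y. G y \<partial>lborel)"
    proof -
      have "integral {- real N..real N + 1} G = (\<integral>y. indicator {- real N..real N + 1} y *\<^sub>R G y \<partial>lborel)" for N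
      proof -
        have "set_integrable lborel {- real N..real N + 1} G"
          unfolding set_integrable_def using \<open>integrable lborel G\<close>
          by (intro integrable_mult_indicator) auto
        then show ?thesis
          using set_borel_integral_eq_integral(2) unfolding set_lebesgue_integral_def by metis
      qed
      moreover have "(\<lambda>N. \<integral>y. indicator {- real N..real N + 1} y *\<^sub>R G y \<partial>lborel) \<longlonglongrightarrow> (\<integral>y. G y \<partial>lborel)"
      proof (rule integral_dominated_convergence[where w = "\<lambda>y. norm (G y)"])
        show "integrable lborel (\<lambda>y. norm (G y))" using \<open>integrable lborel G\<close> by simp
        show "G \<in> borel_measurable lborel" using \<open>integrable lborel G\<close> by simp
        then show "(\<lambda>y. indicator {- real N..real N + 1} y *\<^sub>R G y) \<in> borel_measurable lborel" for N
          by (intro borel_measurable_scaleR) auto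
        show "AE y in lborel. (\<lambda>N. indicator {- real N..real N + 1} y *\<^sub>R G y) \<longlonglongrightarrow> G y"
        proof (intro AE_I2 tendsto_eventually)
          fix y
          obtain N0 :: nat where "\<bar>y\<bar> \<le> real N0" using real_arch_simple by blast
          then have "indicator {- real N..real N + 1} y *\<^sub>R G y = G y" if "N0 \<le> N" for N
            using that by (auto simp: indicator_def)
          then show "\<forall>\<^sub>F N in sequentially. indicator {- real N..real N + 1} y *\<^sub>R G y = G y"
            by (rule eventually_sequentiallyI)
        qed
        show "AE y in lborel. norm (indicator {- real N..real N + 1} y *\<^sub>R G y) \<le> norm (G y)" for N
          by (auto simp: indicator_def)
      qed
      ultimately show ?thesis by simp
    qed
    ultimately have "J = (\<integral>y. G y \<partial>lborel)" using IJ(3) by (auto intro: LIMSEQ_unique)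
    then show ?thesis using IJ(2) by (simp add: hat G_def integral_unique)
  qed
  have coeffR: "integral {0..1} (\<lambda>x. R x * cis (2 * pi * k * x)) = Fhat (- k)" for k :: int
  proof -
    have unif: "uniform_limit {0..1::real} (\<lambda>N x. (\<Sum>n\<in>{- int N..int N}. Fhat n * cis (2 * pi * n * x)) * cis (2 * pi * k * x))
        (\<lambda>x. R x * cis (2 * pi * k * x)) sequentially"
    proof (rule uniform_lim_mult)
      show "uniform_limit {0..1::real} (\<lambda>N x. \<Sum>n\<in>{- int N..int N}. Fhat n * cis (2 * pi * n * x)) R sequentially"
        using unif_R by (rule uniform_limit_on_subset) auto
      have "continuous_on {0..1} R" using contR by (rule continuous_on_subset) auto
      then show "bounded (R ` {0..1})"
        by (intro compact_imp_bounded compact_continuous_image) auto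
      show "bounded ((\<lambda>x. cis (2 * pi * k * x)) ` {0..1})"
        by (auto simp: bounded_iff intro!: exI[of _ 1])
    qed (rule uniform_limit_const)
    obtain I J where IJ:
      "\<And>N. ((\<lambda>x. (\<Sum>n\<in>{- int N..int N}. Fhat n * cis (2 * pi * n * x)) * cis (2 * pi * k * x)) has_integral I N) {0..1}"
      "((\<lambda>x. R x * cis (2 * pi * k * x)) has_integral J) {0..1}" "I \<longlonglongrightarrow> J"
      by (rule uniform_limit_integral[OF unif]) (auto intro!: continuous_intros cont_cis)
    have orth: "((\<lambda>x. cis (2 * pi * of_int m * x)) has_integral (if m = 0 then 1 else 0)) {0..1}" for m :: int
    proof (cases "m = 0")
      case True
      then show ?thesis using has_integral_const_real[of "1::complex" 0 1] by simp
    next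
      case False
      define c where "c = 2 * pi * real_of_int m"
      have c: "c \<noteq> 0" "cis c = 1" using False by (auto simp: c_def)
      have "((\<lambda>x. cis (c * x)) has_integral (cis (c * 1) / (\<i> * c) - cis (c * 0) / (\<i> * c))) {0..1}"
      proof (rule fundamental_theorem_of_calculus)
        fix x :: real
        have "((\<lambda>z. exp (\<i> * (c * z)) / (\<i> * c)) has_field_derivative exp (\<i> * (c * x))) (at (of_real x))"
          using c by (auto intro!: derivative_eq_intros) (simp add: mult.left_commute[of \<i>])
        then show "((\<lambda>x. cis (c * x) / (\<i> * c)) has_vector_derivative cis (c * x)) (at x within {0..1})"
          by (auto simp: cis_conv_exp dest!: has_vector_derivative_real_field intro: has_vector_derivative_at_within)
      qed simp
      then show ?thesis using False c by (simp add: c_def)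
    qed
    have "I N = Fhat (- k)" if "nat \<bar>k\<bar> \<le> N" for N
    proof -
      have "((\<lambda>x. \<Sum>n\<in>{- int N..int N}. Fhat n * cis (2 * pi * of_int (n + k) * x)) has_integral
          (\<Sum>n\<in>{- int N..int N}. Fhat n * (if n + k = 0 then 1 else 0))) {0..1}"
        by (intro has_integral_sum has_integral_mult_right orth) auto
      moreover have "(\<Sum>n\<in>{- int N..int N}. Fhat n * cis (2 * pi * of_int (n + k) * x)) =
          (\<Sum>n\<in>{- int N..int N}. Fhat n * cis (2 * pi * n * x)) * cis (2 * pi * k * x)" for x
      proof -
        have "cis (2 * pi * of_int (n + k) * x) = cis (2 * pi * n * x) * cis (2 * pi * k * x)" for n
          by (simp add: cis_mult algebra_simps)
        then show ?thesis by (simp only: sum_distrib_right mult.assoc)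
      qed
      moreover have "(\<Sum>n\<in>{- int N..int N}. Fhat n * (if n + k = 0 then 1 else 0)) = Fhat (- k)"
      proof -
        have "(\<Sum>n\<in>{- int N..int N}. Fhat n * (if n + k = 0 then 1 else 0))
          = (\<Sum>n\<in>{- int N..int N}. if n = - k then Fhat n else 0)"
          by (intro sum.cong) (auto simp: eq_neg_iff_add_eq_0)
        moreover have "- k \<in> {- int N..int N}" using that by auto
        ultimately show ?thesis by (simp only: sum.delta[OF finite_atLeastAtMost_int] if_True)
      qed
      ultimately show ?thesis using IJ(1)[of N] by (metis (no_types, lifting) has_integral_unique has_integral_eq)
    qed
    then have "I \<longlonglongrightarrow> Fhat (- k)"
      by (intro tendsto_eventually eventually_sequentiallyI)
    then have "J = Fhat (- k)" using IJ(3) LIMSEQ_unique by blast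
    then show ?thesis using IJ(2) by (simp add: integral_unique)
  qed
  have "zero_coeffs (\<lambda>x. L x - R x)"
    unfolding zero_coeffs_def
  proof (intro conjI allI)
    show "continuous_on UNIV (\<lambda>x. L x - R x)" by (intro continuous_intros contL contR)
    fix k :: int
    have "integral {0..1} (\<lambda>x. (L x - R x) * cis (2 * pi * k * x)) =
      integral {0..1} (\<lambda>x. L x * cis (2 * pi * k * x)) - integral {0..1} (\<lambda>x. R x * cis (2 * pi * k * x))"
      unfolding left_diff_distrib
      by (intro Henstock_Kurzweil_Integration.integral_diff integrable_continuous_real
        continuous_intros cont_cis continuous_on_subset[OF contL] continuous_on_subset[OF contR]) auto
    then show "integral {0..1} (\<lambda>x. (L x - R x) * cis (2 * pi * k * x)) = 0"
      using coeffL coeffR by simp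
  qed
  from fourier_uniqueness[OF this _ x] have "L x = R x" by (simp add: perL perR)
  then show ?thesis by (simp add: L_def R_def)
qed

section \<open>The transformation law of the eta function\<close>

lemma gaussian_integrable:
  assumes "c > 0"
  shows "integrable lborel (\<lambda>y. of_real (exp (- c * y\<^sup>2)) * cis (t * y))"
proof -
  define a where "a = sqrt (2 * c)"
  have a: "a \<noteq> 0" "a\<^sup>2 = 2 * c" using assms by (auto simp: a_def)
  have "integrable lborel std_normal_density" by (rule integrable_normal_density) simp
  then have "integrable lborel (\<lambda>y. std_normal_density (0 + a * y))"
    using a by (intro lborel_integrable_real_affine)
  then have "integrable lborel (\<lambda>y. sqrt (2 * pi) * std_normal_density (0 + a * y))" by simp
  also have "(\<lambda>y. sqrt (2 * pi) * std_normal_density (0 + a * y)) = (\<lambda>y. exp (- c * y\<^sup>2))"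
    by (auto simp: std_normal_density_def power_mult_distrib a fun_eq_iff)
  finally have 1: "integrable lborel (\<lambda>y. exp (- c * y\<^sup>2))" .
  have "continuous_on UNIV (\<lambda>y. of_real (exp (- c * y\<^sup>2)) * cis (t * y))"
    by (auto simp: cis_conv_exp intro!: continuous_intros)
  then have "(\<lambda>y. of_real (exp (- c * y\<^sup>2)) * cis (t * y)) \<in> borel_measurable lborel"
    using borel_measurable_continuous_onI by simp
  then show ?thesis
    by (rule Bochner_Integration.integrable_bound[OF 1]) (simp add: norm_mult)
qed

text \<open>A rescaled form of the characteristic function of the standard normal distribution; the
  factor a = sqrt (2 c) turns exp (-x^2/2) into exp (-c x^2).\<close>

lemma gaussian_fourier_transform:
  assumes "c > 0"
  shows "(\<integral>y. of_real (exp (- c * y\<^sup>2)) * cis (t * y) \<partial>lborel) = of_real (sqrt (pi / c) * exp (- t\<^sup>2 / (4 * c)))"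
proof -
  define a where "a = sqrt (2 * c)"
  have a: "a > 0" "a\<^sup>2 = 2 * c" using assms by (auto simp: a_def)
  define s where "s = t / a"
  have "of_real (exp (- s\<^sup>2 / 2)) = (CLINT x | std_normal_distribution. iexp (s * x))"
    using char_std_normal_distribution unfolding char_def by metis
  also have "\<dots> = (CLINT x | lborel. std_normal_density x *\<^sub>R iexp (s * x))"
    by (rule integral_density) auto
  also have "\<dots> = \<bar>a\<bar> *\<^sub>R (CLINT x | lborel. std_normal_density (0 + a * x) *\<^sub>R iexp (s * (0 + a * x)))"
    using a by (intro lborel_integral_real_affine) auto
  also have "(\<lambda>x. std_normal_density (0 + a * x) *\<^sub>R iexp (s * (0 + a * x)))
    = (\<lambda>x. of_real (1 / sqrt (2 * pi)) * (of_real (exp (- c * x\<^sup>2)) * cis (t * x)))"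
    using a by (auto simp: fun_eq_iff std_normal_density_def power_mult_distrib s_def cis_conv_exp
      scaleR_conv_of_real)
  also have "(CLINT x | lborel. of_real (1 / sqrt (2 * pi)) * (of_real (exp (- c * x\<^sup>2)) * cis (t * x)))
    = of_real (1 / sqrt (2 * pi)) * (CLINT x | lborel. of_real (exp (- c * x\<^sup>2)) * cis (t * x))"
    by (rule integral_mult_right_zero)
  finally have "of_real (exp (- s\<^sup>2 / 2)) =
      complex_of_real (a / sqrt (2 * pi)) * (CLINT x | lborel. of_real (exp (- c * x\<^sup>2)) * cis (t * x))"
    using a by (simp add: scaleR_conv_of_real)
  then have "(CLINT x | lborel. of_real (exp (- c * x\<^sup>2)) * cis (t * x))
      = of_real (sqrt (2 * pi) / a * exp (- s\<^sup>2 / 2))"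
    using a by (simp add: field_simps)
  moreover have "sqrt (2 * pi) / a = sqrt (pi / c)"
    unfolding a_def by (simp flip: real_sqrt_divide)
  moreover have "s\<^sup>2 / 2 = t\<^sup>2 / (4 * c)" using a by (simp add: s_def power_divide)
  ultimately show ?thesis by simp
qed

lemma gaussian_translate_bound:
  fixes c M x :: real and n :: int
  assumes "c > 0" "\<bar>x\<bar> \<le> M"
  shows "exp (- c * (x + n)\<^sup>2) \<le> exp (c * M\<^sup>2) * exp (- c / 2) ^ nat \<bar>n\<bar>"
proof -
  \<comment> \<open>Equivalent to n^2 \<le> 2 (x + n)^2 + 2 x^2. Together with |n| \<le> n^2 for
    integers this turns Gaussian decay into a geometric majorant that is uniform in
    \<open>x\<close>.\<close>
  have "0 \<le> (x + n + x)\<^sup>2" by simp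
  then have "(real_of_int n)\<^sup>2 \<le> 2 * (x + n)\<^sup>2 + 2 * x\<^sup>2"
    by (simp add: power2_eq_square algebra_simps)
  moreover have "x\<^sup>2 \<le> M\<^sup>2" using assms(2) by (simp add: abs_le_square_iff[symmetric])
  moreover have "real_of_int \<bar>n\<bar> \<le> (real_of_int n)\<^sup>2"
  proof -
    have "\<bar>n\<bar> \<le> n\<^sup>2"
    proof (cases "n = 0")
      case False
      then have "\<bar>n\<bar> * 1 \<le> \<bar>n\<bar> * \<bar>n\<bar>" by (intro mult_left_mono) linarith+
      then show ?thesis by (simp add: power2_eq_square)
    qed simp
    then show ?thesis by (metis of_int_le_iff of_int_power)
  qed
  ultimately have "- (x + n)\<^sup>2 \<le> M\<^sup>2 - \<bar>n\<bar> / 2" by simp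
  from mult_left_mono[OF this, of c] assms(1)
  have "- c * (x + n)\<^sup>2 \<le> c * M\<^sup>2 + real (nat \<bar>n\<bar>) * (- c / 2)" by (simp add: algebra_simps)
  then have "exp (- c * (x + n)\<^sup>2) \<le> exp (c * M\<^sup>2 + real (nat \<bar>n\<bar>) * (- c / 2))" by simp
  also have "\<dots> = exp (c * M\<^sup>2) * exp (- c / 2) ^ nat \<bar>n\<bar>"
    unfolding exp_add exp_of_nat_mult ..
  finally show ?thesis .
qed

lemma gaussian_translates_summable:
  fixes c x :: real
  assumes "c > 0"
  shows "(\<lambda>n::int. exp (- c * (x + n)\<^sup>2)) summable_on UNIV"
proof (rule summable_on_comparison_test)
  show "(\<lambda>n::int. exp (c * \<bar>x\<bar>\<^sup>2) * exp (- c / 2) ^ nat \<bar>n\<bar>) summable_on UNIV"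
    using assms by (intro summable_on_cmult_right summable_on_int_power_abs) auto
qed (use gaussian_translate_bound[OF assms order_refl] in auto)

section \<open>Dedekind's eta function on the imaginary axis\<close>

definition eta_imag :: "real \<Rightarrow> complex" where
  "eta_imag t = of_real (exp (- pi * t / 12)) * f_minus (of_real (exp (- 2 * pi * t)))"

text \<open>Completing the square: n (3n - 1)/2 + 1/24 = 3/2 (n - 1/6)^2. The prefactor of
  \<open>eta_imag\<close> supplies the 1/24 and makes each term of the series a shifted
  Gaussian.\<close>

definition eta_term :: "real \<Rightarrow> int \<Rightarrow> complex" where
  "eta_term t n = cis (pi * n) * of_real (exp (- (3 * pi * t) * (n - 1 / 6)\<^sup>2))"

lemma eta_imag_eq:
  assumes "t > 0"
  shows "eta_imag t = (\<Sum>\<^sub>\<infinity>n. eta_term t n)"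
proof -
  have eq: "of_real (exp (- pi * t / 12)) * pent (of_real (exp (- 2 * pi * t))) n = eta_term t n" for n
  proof -
    define m where "m = n * (3 * n - 1) div 2"
    have "even (n * (3 * n - 1))" by auto
    then have "2 * m = n * (3 * n - 1)" unfolding m_def by simp
    then have m: "2 * real_of_int m = n * (3 * n - 1)"
      by (metis of_int_1 of_int_diff of_int_mult of_int_numeral)
    have h1: "(-1) powi n = cis (pi * n)"
      by (metis cis_pi cis_power_int mult.commute)
    have h2: "complex_of_real (exp (- 2 * pi * t)) powi m = of_real (exp (m * (- 2 * pi * t)))"
      by (metis exp_power_int of_real_power_int)
    have h3: "- pi * t / 12 + m * (- 2 * pi * t) = - (3 * pi * t) * (n - 1 / 6)\<^sup>2"
    proof -
      have "- pi * t / 12 + m * (- 2 * pi * t) = - pi * t / 12 - (2 * real_of_int m) * (pi * t)" by simp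
      also have "\<dots> = - (3 * pi * t) * (n - 1 / 6)\<^sup>2"
        unfolding m by (simp add: power2_eq_square field_simps)
      finally show ?thesis .
    qed
    have "of_real (exp (- pi * t / 12)) * (cis (pi * n) * of_real (exp (m * (- 2 * pi * t))))
        = cis (pi * n) * complex_of_real (exp (- pi * t / 12) * exp (m * (- 2 * pi * t)))"
      by (simp only: of_real_mult mult_ac)
    then show ?thesis
      unfolding pent_def m_def[symmetric] eta_term_def h1 h2 h3[symmetric] exp_add .
  qed
  have "(pent (of_real (exp (- 2 * pi * t))) has_sum f_minus (of_real (exp (- 2 * pi * t)))) UNIV"
    using assms by (intro pent_has_sum) simp
  from has_sum_cmult_right[OF this, of "of_real (exp (- pi * t / 12))"]
  have "(eta_term t has_sum eta_imag t) UNIV"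
    unfolding eta_imag_def by (simp only: eq)
  then show ?thesis by (simp add: infsumI)
qed

lemma infsum_int_mod_3:
  fixes f :: "int \<Rightarrow> complex"
  assumes "f summable_on UNIV"
  shows "infsum f UNIV = (\<Sum>\<^sub>\<infinity>n. f (3 * n)) + (\<Sum>\<^sub>\<infinity>n. f (3 * n + 1)) + (\<Sum>\<^sub>\<infinity>n. f (3 * n + 2))"
proof -
  define A where "A r = range (\<lambda>n::int. 3 * n + r)" for r
  have inj: "inj (\<lambda>n::int. 3 * n + r)" for r by (auto simp: inj_on_def)
  have sum: "infsum f (A r) = (\<Sum>\<^sub>\<infinity>n. f (3 * n + r))" for r
    unfolding A_def by (subst infsum_reindex[OF inj]) (simp add: o_def)
  have UNIV: "UNIV = A 0 \<union> A 1 \<union> A 2"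
  proof -
    have "k \<in> A 0 \<union> A 1 \<union> A 2" for k
    proof -
      have "k mod 3 = 0 \<or> k mod 3 = 1 \<or> k mod 3 = 2" by presburger
      moreover have "k \<in> A (k mod 3)"
        unfolding A_def by (rule range_eqI[of _ _ "k div 3"]) simp
      ultimately show ?thesis by auto
    qed
    then show ?thesis by blast
  qed
  have disj: "A 0 \<inter> A 1 = {}" "(A 0 \<union> A 1) \<inter> A 2 = {}"
    unfolding A_def by (auto, presburger+)
  have s: "f summable_on B" for B using assms by (rule summable_on_subset_banach) auto
  have "infsum f UNIV = infsum f (A 0 \<union> A 1 \<union> A 2)" by (simp only: UNIV[symmetric])
  also have "\<dots> = infsum f (A 0) + infsum f (A 1) + infsum f (A 2)"
    by (simp only: infsum_Un_disjoint[OF s s disj(2)] infsum_Un_disjoint[OF s s disj(1)])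
  finally show ?thesis by (simp add: sum)
qed

text \<open>Poisson summation yields Gaussians in (k - 1/2)/3, three times as dense as the eta
  series at 1/t. The indices divisible by 3 and those congruent to 1 each reproduce that series up
  to a phase, and the remaining class cancels in pairs.\<close>

lemma eta_imag_inversion:
  assumes "t > 0"
  shows "eta_imag (1 / t) = of_real (sqrt t) * eta_imag t"
proof -
  define c where "c = 3 * pi * t"
  define c' where "c' = 3 * pi / t"
  have c: "c > 0" "c' > 0" using assms by (auto simp: c_def c'_def)
  define F where "F y = cis (pi * y) * of_real (exp (- c * y\<^sup>2))" for y
  define D where "D k = of_real (exp (- (c' / 9) * (k - 1 / 2)\<^sup>2)) * cis (5 * pi * k / 3)" for k :: int
  define Fhat where "Fhat k = complex_of_real (sqrt (pi / c) * exp (- (pi - 2 * pi * k)\<^sup>2 / (4 * c)))" for k :: int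
  have Fhat_eq: "Fhat k = of_real (sqrt (pi / c) * exp (- (c' / 9) * (k - 1 / 2)\<^sup>2))" for k
  proof -
    have "(pi - 2 * pi * k)\<^sup>2 / (4 * c) = c' / 9 * (k - 1 / 2)\<^sup>2"
      using assms by (simp add: c_def c'_def power2_eq_square field_simps)
    then show ?thesis unfolding Fhat_def by simp
  qed
  have gs: "(\<lambda>k::int. exp (- (c' / 9) * (k - 1 / 2)\<^sup>2)) summable_on UNIV"
    using gaussian_translates_summable[of "c' / 9" "- 1 / 2"] c by (simp add: algebra_simps)
  \<comment> \<open>The shift is -1/6, moved into [0, 1]; the reindexing by \<open>n - 1\<close>
    below undoes this.\<close>
  have "(\<Sum>\<^sub>\<infinity>n::int. F (5 / 6 + n)) = (\<Sum>\<^sub>\<infinity>k. Fhat k * cis (2 * pi * k * (5 / 6)))"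
  proof (rule poisson_summation)
    show "continuous_on UNIV F"
      unfolding F_def by (auto simp: cis_conv_exp intro!: continuous_intros)
    show "\<exists>b. b summable_on UNIV \<and> (\<forall>x\<in>{-M..M}. \<forall>n::int. norm (F (x + of_int n)) \<le> b n)" for M :: real
      using c gaussian_translate_bound[of c _ M]
      by (intro exI[of _ "\<lambda>n. exp (c * M\<^sup>2) * exp (- c / 2) ^ nat \<bar>n\<bar>"])
        (auto simp: F_def norm_mult intro!: summable_on_cmult_right summable_on_int_power_abs)
    show "integrable lborel F"
      unfolding F_def using gaussian_integrable[OF c(1), of pi] by (simp add: mult.commute)
    show "Fhat k = (\<integral>y. F y * cis (- 2 * pi * k * y) \<partial>lborel)" for k
    proof -
      have "F y * cis (- 2 * pi * k * y) = of_real (exp (- c * y\<^sup>2)) * cis ((pi - 2 * pi * k) * y)" for y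
        unfolding F_def by (simp add: cis_mult algebra_simps)
      then show ?thesis unfolding Fhat_def by (simp only: gaussian_fourier_transform[OF c(1)])
    qed
    show "(\<lambda>k. norm (Fhat k)) summable_on UNIV"
      unfolding Fhat_eq norm_of_real abs_mult using gs by (intro summable_on_cmult_right) simp
  qed simp
  also have "(\<Sum>\<^sub>\<infinity>k. Fhat k * cis (2 * pi * k * (5 / 6))) = (\<Sum>\<^sub>\<infinity>k. of_real (sqrt (pi / c)) * D k)"
    unfolding Fhat_eq D_def by (intro infsum_cong) (simp add: algebra_simps)
  also have "\<dots> = of_real (sqrt (pi / c)) * infsum D UNIV"
    by (rule infsum_cmult_right')
  also have "infsum D UNIV = (1 + cis (- pi / 3)) * eta_imag (1 / t)"
  proof -
    have trm: "eta_term (1 / t) n = cis (pi * n) * of_real (exp (- c' * (n - 1 / 6)\<^sup>2))" for n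
      unfolding eta_term_def c'_def by simp
    have cis_odd: "cis (5 * pi * n) = cis (pi * n)" for n :: int
    proof -
      have "cis (5 * pi * n) = cis (pi * n) * cis (2 * pi * of_int (2 * n))"
        by (simp add: cis_mult algebra_simps)
      moreover have "cis (2 * pi * of_int (2 * n)) = 1" by (rule cis_multiple_2pi) simp
      ultimately show ?thesis by (simp only: mult_1_right)
    qed
    have cis_neg: "cis (pi * of_int (- n)) = cis (pi * n)" for n :: int
    proof -
      have "cis (pi * n) = cis (pi * of_int (- n)) * cis (2 * pi * of_int n)"
        by (simp add: cis_mult algebra_simps)
      then show ?thesis by simp
    qed
    have "(\<lambda>k. norm (D k)) summable_on UNIV" using gs by (simp add: D_def norm_mult)
    then have "D summable_on UNIV" by (rule abs_summable_summable)
    note infsum_int_mod_3[OF this]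
    moreover have "(\<Sum>\<^sub>\<infinity>n. D (3 * n)) = eta_imag (1 / t)"
    proof -
      have "D (3 * n) = eta_term (1 / t) n" for n
      proof -
        have "- (c' / 9) * (of_int (3 * n) - 1 / 2)\<^sup>2 = - c' * (n - 1 / 6)\<^sup>2"
          by (simp add: power2_eq_square field_simps)
        moreover have "cis (5 * pi * of_int (3 * n) / 3) = cis (pi * n)"
          using cis_odd[of n] by (simp add: mult.assoc)
        ultimately show ?thesis unfolding D_def trm by (simp only: mult.commute)
      qed
      then show ?thesis using assms by (simp add: eta_imag_eq)
    qed
    moreover have "(\<Sum>\<^sub>\<infinity>n. D (3 * n + 1)) = cis (- pi / 3) * eta_imag (1 / t)"
    proof -
      have "D (3 * (- n) + 1) = cis (- pi / 3) * eta_term (1 / t) n" for n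
      proof -
        have 1: "- (c' / 9) * (of_int (3 * (- n) + 1) - 1 / 2)\<^sup>2 = - c' * (n - 1 / 6)\<^sup>2"
          by (simp add: power2_eq_square field_simps)
        have "cis (5 * pi * of_int (3 * (- n) + 1) / 3) = cis (5 * pi * of_int (- n)) * (cis (- pi / 3) * cis (2 * pi))"
          by (simp add: cis_mult field_simps del: cis_2pi)
        then have 2: "cis (5 * pi * of_int (3 * (- n) + 1) / 3) = cis (- pi / 3) * cis (pi * n)"
          unfolding cis_odd cis_neg by simp
        show ?thesis unfolding D_def trm 1 2 by simp
      qed
      moreover have "bij_betw (\<lambda>n::int. - n) UNIV UNIV"
        by (rule bij_betwI[of _ _ _ uminus]) auto
      ultimately have "(\<Sum>\<^sub>\<infinity>n. D (3 * n + 1)) = (\<Sum>\<^sub>\<infinity>n. cis (- pi / 3) * eta_term (1 / t) n)"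
        using infsum_reindex_bij_betw[of "\<lambda>n::int. - n" UNIV UNIV "\<lambda>n. D (3 * n + 1)"] by simp
      then show ?thesis using assms by (simp add: eta_imag_eq infsum_cmult_right')
    qed
    \<comment> \<open>Under n \<mapsto> -1 - n the centred index 3n + 3/2 changes sign, which the
      Gaussian ignores, while the phase changes by the factor -1.\<close>
    moreover have "(\<Sum>\<^sub>\<infinity>n. D (3 * n + 2)) = 0"
    proof -
      have "D (3 * (- 1 - n) + 2) = - D (3 * n + 2)" for n
      proof -
        have 1: "- (c' / 9) * (of_int (3 * (- 1 - n) + 2) - 1 / 2)\<^sup>2 = - (c' / 9) * (of_int (3 * n + 2) - 1 / 2)\<^sup>2"
          by (simp add: power2_eq_square field_simps)
        have "5 * pi * of_int (3 * (- 1 - n) + 2) / 3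
            = 5 * pi * of_int (3 * n + 2) / 3 + (- pi + 2 * pi * of_int (- 5 * n - 2))"
          by (simp add: field_simps)
        then have "cis (5 * pi * of_int (3 * (- 1 - n) + 2) / 3)
            = cis (5 * pi * of_int (3 * n + 2) / 3) * (cis (- pi) * cis (2 * pi * of_int (- 5 * n - 2)))"
          by (simp only: cis_mult)
        moreover have "cis (2 * pi * of_int (- 5 * n - 2)) = 1" by (rule cis_multiple_2pi) simp
        ultimately have 2: "cis (5 * pi * of_int (3 * (- 1 - n) + 2) / 3) = - cis (5 * pi * of_int (3 * n + 2) / 3)"
          by (simp only: mult_1_right) (simp add: cis.code complex_eq_iff)
        show ?thesis unfolding D_def 1 2 by simp
      qed
      moreover have "bij_betw (\<lambda>n::int. - 1 - n) UNIV UNIV"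
        by (rule bij_betwI[of _ _ _ "\<lambda>n. - 1 - n"]) auto
      ultimately have "(\<Sum>\<^sub>\<infinity>n. D (3 * n + 2)) = (\<Sum>\<^sub>\<infinity>n. - D (3 * n + 2))"
        using infsum_reindex_bij_betw[of "\<lambda>n::int. - 1 - n" UNIV UNIV "\<lambda>n. D (3 * n + 2)"] by simp
      then show ?thesis by (simp add: infsum_uminus)
    qed
    ultimately show ?thesis by (simp add: algebra_simps)
  qed
  \<comment> \<open>The same phase arises on the other side from the value of F at n - 1/6, so it
    cancels, and sqrt 3 corrects the factor 1/sqrt (3t) to 1/sqrt t.\<close>
  also have "1 + cis (- pi / 3) = sqrt 3 * cis (- (pi / 6))"
    by (simp add: complex_eq_iff cos_60 sin_60 cos_30 sin_30 flip: minus_divide_left)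
  finally have "(\<Sum>\<^sub>\<infinity>n::int. F (5 / 6 + n)) =
    of_real (sqrt (pi / c)) * (sqrt 3 * cis (- (pi / 6)) * eta_imag (1 / t))" .
  moreover have "(\<Sum>\<^sub>\<infinity>n::int. F (5 / 6 + n)) = cis (- (pi / 6)) * eta_imag t"
  proof -
    have "F (5 / 6 + of_int (n - 1)) = cis (- (pi / 6)) * eta_term t n" for n
    proof -
      have e: "5 / 6 + of_int (n - 1) = n - (1 / 6 :: real)" by simp
      have "cis (pi * (n - 1 / 6)) = cis (- (pi / 6)) * cis (pi * n)"
        by (simp add: cis_mult algebra_simps)
      then show ?thesis unfolding e F_def eta_term_def c_def by simp
    qed
    moreover have "bij_betw (\<lambda>n::int. n - 1) UNIV UNIV"
      by (rule bij_betwI[of _ _ _ "\<lambda>n. n + 1"]) auto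
    ultimately have "(\<Sum>\<^sub>\<infinity>n::int. F (5 / 6 + n)) = (\<Sum>\<^sub>\<infinity>n. cis (- (pi / 6)) * eta_term t n)"
      using infsum_reindex_bij_betw[of "\<lambda>n::int. n - 1" UNIV UNIV "\<lambda>n. F (5 / 6 + of_int n)"] by simp
    then show ?thesis using assms by (simp add: eta_imag_eq infsum_cmult_right')
  qed
  ultimately have "cis (- (pi / 6)) * eta_imag t
      = cis (- (pi / 6)) * (of_real (sqrt (pi / c) * sqrt 3) * eta_imag (1 / t))" by simp
  then have "eta_imag t = of_real (sqrt (pi / c) * sqrt 3) * eta_imag (1 / t)" by simp
  also have "sqrt (pi / c) * sqrt 3 = 1 / sqrt t"
    using assms by (simp add: c_def real_sqrt_divide real_sqrt_mult)
  finally show ?thesis using assms by simp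
qed

text \<open>The square of Dedekind's eta function. Squaring makes the automorphy factor under
  inversion single valued and reduces the multipliers to twelfth roots of unity.\<close>

definition eta_sq :: "complex \<Rightarrow> complex" where
  "eta_sq \<tau> = exp (2 * pi * \<i> * \<tau> / 12) * f_minus (exp (2 * pi * \<i> * \<tau>)) ^ 2"

lemma norm_nome: "norm (exp (2 * pi * \<i> * \<tau>)) = exp (- 2 * pi * Im \<tau>)"
  by simp

lemma nome_in_ball: "Im \<tau> > 0 \<Longrightarrow> norm (exp (2 * pi * \<i> * \<tau>)) < 1"
  by simp

lemma eta_sq_nonzero: "Im \<tau> > 0 \<Longrightarrow> eta_sq \<tau> \<noteq> 0"
  unfolding eta_sq_def using f_minus_nonzero[OF nome_in_ball] by simp

lemma f_minus_nome_holomorphic: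
  assumes "g holomorphic_on S" "\<And>z. z \<in> S \<Longrightarrow> Im (g z) > 0"
  shows "(\<lambda>z. f_minus (exp (2 * pi * \<i> * g z))) holomorphic_on S"
  by (rule holomorphic_on_compose_gen[OF _ f_minus_holomorphic, unfolded o_def])
    (use assms nome_in_ball in \<open>auto intro!: holomorphic_intros\<close>)

lemma eta_sq_holomorphic:
  assumes "g holomorphic_on S" "\<And>z. z \<in> S \<Longrightarrow> Im (g z) > 0"
  shows "(\<lambda>z. eta_sq (g z)) holomorphic_on S"
  unfolding eta_sq_def
  by (intro holomorphic_intros f_minus_nome_holomorphic assms) auto

lemma Im_inversion_pos: "Im \<tau> > 0 \<Longrightarrow> Im (- 1 / \<tau>) > 0"
  by (cases "\<tau> = 0") (auto simp: Im_divide sum_power2_gt_zero_iff)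

text \<open>On the positive imaginary axis this is the square of \<open>eta_imag_inversion\<close>;
  the identity theorem extends it to the half plane.\<close>

theorem eta_sq_inversion:
  assumes "Im \<tau> > 0"
  shows "eta_sq (- 1 / \<tau>) = - \<i> * \<tau> * eta_sq \<tau>"
proof -
  define S where "S = {z. Im z > 0}"
  define U where "U = (\<lambda>t::real. \<i> * t) ` {0<..}"
  have "eta_sq (- 1 / \<tau>) + \<i> * \<tau> * eta_sq \<tau> = 0"
  proof (rule analytic_continuation[of "\<lambda>\<tau>. eta_sq (- 1 / \<tau>) + \<i> * \<tau> * eta_sq \<tau>" S U \<i>])
    show "(\<lambda>\<tau>. eta_sq (- 1 / \<tau>) + \<i> * \<tau> * eta_sq \<tau>) holomorphic_on S"
      using Im_inversion_pos by (intro holomorphic_intros eta_sq_holomorphic) (auto simp: S_def)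
    show "open S" "connected S"
      unfolding S_def by (auto intro: open_halfspace_Im_gt convex_connected convex_halfspace_Im_gt)
    show "U \<subseteq> S" "\<i> \<in> S" "\<tau> \<in> S" using assms by (auto simp: U_def S_def)
    show "\<i> islimpt U"
      unfolding islimpt_approachable
    proof (intro allI impI)
      fix e :: real assume "e > 0"
      then show "\<exists>x'\<in>U. x' \<noteq> \<i> \<and> dist x' \<i> < e"
        by (intro bexI[of _ "\<i> * of_real (1 + e / 2)"])
          (auto simp: U_def dist_norm algebra_simps norm_mult complex_eq_iff)
    qed
    fix z assume "z \<in> U"
    then obtain t where t: "t > 0" "z = \<i> * of_real t" by (auto simp: U_def)
    have E: "eta_sq (\<i> * of_real s) = eta_imag s ^ 2" for s
    proof -
      have "exp (2 * pi * \<i> * (\<i> * of_real s)) = of_real (exp (- 2 * pi * s))"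
        by (simp add: exp_of_real[symmetric] algebra_simps)
      moreover have "exp (2 * pi * \<i> * (\<i> * of_real s) / 12) = of_real (exp (- pi * s / 12)) ^ 2"
        by (simp add: exp_of_real[symmetric] exp_double[symmetric] algebra_simps)
      ultimately show ?thesis
        unfolding eta_sq_def eta_imag_def by (simp only: power_mult_distrib)
    qed
    have "- 1 / z = \<i> * of_real (1 / t)" using t by (simp add: field_simps)
    then have "eta_sq (- 1 / z) = (of_real (sqrt t) * eta_imag t) ^ 2"
      by (simp only: E eta_imag_inversion[OF t(1)])
    also have "\<dots> = of_real t * eta_imag t ^ 2"
      using t(1) by (simp add: power_mult_distrib flip: of_real_power)
    finally have "eta_sq (- 1 / z) = of_real t * eta_imag t ^ 2" .
    then show "eta_sq (- 1 / z) + \<i> * z * eta_sq z = 0"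
      unfolding t(2) E by simp
  qed
  then show ?thesis by (simp add: add_eq_0_iff)
qed

lemma eta_sq_add_int: "eta_sq (\<tau> + of_int n) = cis (pi / 6 * n) * eta_sq \<tau>"
proof -
  have "exp (2 * pi * \<i> * (\<tau> + of_int n)) = exp (2 * pi * \<i> * \<tau>) * exp (\<i> * (2 * pi * of_int n))"
    by (simp add: exp_add[symmetric] algebra_simps)
  also have "exp (\<i> * (2 * pi * of_int n)) = cis (2 * pi * n)" by (simp add: cis_conv_exp)
  finally have 1: "exp (2 * pi * \<i> * (\<tau> + of_int n)) = exp (2 * pi * \<i> * \<tau>)" by simp
  have 2: "exp (2 * pi * \<i> * (\<tau> + of_int n) / 12) = cis (pi / 6 * n) * exp (2 * pi * \<i> * \<tau> / 12)"
    by (simp add: exp_add[symmetric] cis_conv_exp add_divide_distrib algebra_simps)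
  show ?thesis unfolding eta_sq_def 1 2 by simp
qed

section \<open>Words in the modular group\<close>

fun word :: "int list \<Rightarrow> int \<Rightarrow> int \<times> int \<times> int \<times> int \<times> int" where
  "word [] m = (1, m, 0, 1, m)"
| "word (n # ns) m =
    (case word ns m of (a, b, c, d, k) \<Rightarrow> (n * a - c, n * b - d, a, b, n + k - 3))"

text \<open>
  The word \<open>word [n\<^sub>1, \<dots>, n\<^sub>r] m\<close> stands for \<open>T\<^bsup>n\<^sub>1\<^esup> S \<dots> T\<^bsup>n\<^sub>r\<^esup> S T\<^bsup>m\<^esup>\<close> in the modular group.
  Its last component is the exponent of the twelfth root of unity in the transformation law.
\<close>

lemma eta_sq_word:
  assumes "word ns m = (a, b, c, d, k)" "Im \<tau> > 0"
  shows "of_int c * \<tau> + of_int d \<noteq> 0 \<and>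
    Im ((of_int a * \<tau> + of_int b) / (of_int c * \<tau> + of_int d)) > 0 \<and>
    eta_sq ((of_int a * \<tau> + of_int b) / (of_int c * \<tau> + of_int d)) =
      cis (pi / 6 * k) * (of_int c * \<tau> + of_int d) * eta_sq \<tau>"
  using assms(1)
proof (induction ns arbitrary: a b c d k)
  case Nil
  then show ?case using assms(2) by (auto simp: eta_sq_add_int)
next
  case (Cons n ns)
  obtain a' b' c' d' k' where w: "word ns m = (a', b', c', d', k')" by (metis prod_cases5)
  define x where "x = of_int a' * \<tau> + of_int b'"
  define y where "y = of_int c' * \<tau> + of_int d'"
  define z where "z = x / y"
  have IH: "y \<noteq> 0" "Im z > 0" "eta_sq z = cis (pi / 6 * k') * y * eta_sq \<tau>"
    using Cons.IH[OF w] by (auto simp: x_def y_def z_def)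
  then have "z \<noteq> 0" by auto
  then have x: "x \<noteq> 0" by (auto simp: z_def)
  have eqs: "a = n * a' - c'" "b = n * b' - d'" "c = a'" "d = b'" "k = n + k' - 3"
    using Cons.prems w by auto
  have num: "of_int a * \<tau> + of_int b = of_int n * x - y"
    by (simp add: eqs x_def y_def algebra_simps)
  have den: "of_int c * \<tau> + of_int d = x" by (simp add: eqs x_def)
  have quot: "(of_int n * x - y) / x = - 1 / z + of_int n"
    using x IH(1) by (simp add: z_def field_simps)
  \<comment> \<open>Since -\<i> is \<open>cis (pi / 6 * (- 3))\<close>, every inversion contributes
    the -3 in the last component of \<open>word\<close>.\<close>
  have phase: "cis (pi / 6 * k) = cis (pi / 6 * n) * (cis (pi / 6 * k') * (- \<i>))"
  proof -
    have "pi / 6 * k = pi / 6 * n + (pi / 6 * k' + - (pi / 2))"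
      unfolding eqs by (simp add: field_simps)
    then have "cis (pi / 6 * k) = cis (pi / 6 * n) * (cis (pi / 6 * k') * cis (- (pi / 2)))"
      by (simp only: cis_mult)
    moreover have "cis (- (pi / 2)) = - \<i>" by (simp add: complex_eq_iff)
    ultimately show ?thesis by simp
  qed
  have "eta_sq (- 1 / z + of_int n) = cis (pi / 6 * n) * (- \<i> * z * eta_sq z)"
    unfolding eta_sq_add_int eta_sq_inversion[OF IH(2)] ..
  also have "\<dots> = cis (pi / 6 * k) * x * eta_sq \<tau>"
    unfolding IH(3) phase using IH(1) by (simp add: z_def)
  finally show ?case
    unfolding num den quot using x Im_inversion_pos[OF IH(2)] by simp
qed

text \<open>The hypotheses \<open>eqs\<close> say diag(\<delta>, 1) (A, B; C, F) = g (a, b; c, d)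
  diag(D, 1). Thus \<delta> z is the image of D \<tau> under the unimodular matrix of the word, and
  its automorphy factor is (C \<tau> + F)/g.\<close>

lemma eta_sq_scaled_word:
  fixes \<delta> g D A B C F a b c d :: int
  assumes w: "word ns m = (a, b, c, d, k)" and "Im \<tau> > 0" "D > 0" "g \<noteq> 0"
    and z: "z * (of_int C * \<tau> + of_int F) = of_int A * \<tau> + of_int B"
    and eqs: "\<delta> * A = g * a * D" "\<delta> * B = g * b" "C = g * c * D" "F = g * d"
  shows "eta_sq (of_int \<delta> * z) =
    cis (pi / 6 * k) * ((of_int C * \<tau> + of_int F) / of_int g) * eta_sq (of_int D * \<tau>)"
proof -
  have "Im (of_int D * \<tau>) > 0" using assms by simp
  note W = eta_sq_word[OF w this]
  have den: "of_int c * (of_int D * \<tau>) + of_int d = (of_int C * \<tau> + of_int F) / of_int g"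
    using \<open>g \<noteq> 0\<close> unfolding eqs by (simp add: field_simps)
  have "of_int g * (of_int a * (of_int D * \<tau>) + of_int b)
      = of_int (g * a * D) * \<tau> + of_int (g * b)" by (simp add: algebra_simps)
  also have "\<dots> = of_int \<delta> * (of_int A * \<tau> + of_int B)"
    unfolding eqs[symmetric] by (simp add: algebra_simps)
  also have "\<dots> = of_int g * (of_int \<delta> * z * ((of_int C * \<tau> + of_int F) / of_int g))"
    unfolding z[symmetric] using \<open>g \<noteq> 0\<close> by simp
  finally have num: "of_int a * (of_int D * \<tau>) + of_int b
      = of_int \<delta> * z * ((of_int C * \<tau> + of_int F) / of_int g)"
    by (rule mult_left_cancel[THEN iffD1, rotated]) (use \<open>g \<noteq> 0\<close> in simp)
  define V where "V = (of_int C * \<tau> + of_int F) / of_int g"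
  have "V \<noteq> 0" "eta_sq (of_int \<delta> * z * V / V) = cis (pi / 6 * k) * V * eta_sq (of_int D * \<tau>)"
    using W unfolding den num V_def by blast+
  then show ?thesis unfolding V_def[symmetric] by simp
qed

section \<open>The eta quotient under Atkin-Lehner maps\<close>

definition w_sq :: "complex \<Rightarrow> complex" where
  "w_sq \<tau> = eta_sq \<tau> * eta_sq (21 * \<tau>) / (eta_sq (3 * \<tau>) * eta_sq (7 * \<tau>))"

text \<open>A quotient of two by two values has weight zero, so the factors \<open>v\<close> cancel.
  What remains is bookkeeping: phases that agree modulo 12 and equal products of the contents
  \<open>g1\<close> to \<open>g4\<close>.\<close>

lemma eta_quotient_move:
  fixes g1 g2 g3 g4 k1 k2 k3 k4 j :: int
  assumes "e1 = cis (pi / 6 * k1) * (v / of_int g1) * x1" "e2 = cis (pi / 6 * k2) * (v / of_int g2) * x2"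
    "e3 = cis (pi / 6 * k3) * (v / of_int g3) * x3" "e4 = cis (pi / 6 * k4) * (v / of_int g4) * x4"
    and "v \<noteq> 0" "k1 + k2 = k3 + k4 + 12 * j" "g1 * g2 = g3 * g4" "g1 * g2 \<noteq> 0"
  shows "e1 * e2 / (e3 * e4) = x1 * x2 / (x3 * x4)"
proof -
  have "cis (pi / 6 * k1) * cis (pi / 6 * k2) = cis (pi / 6 * of_int (k1 + k2))"
    by (simp add: cis_mult add_divide_distrib distrib_left)
  also have "pi / 6 * of_int (k1 + k2) = pi / 6 * k3 + pi / 6 * k4 + 2 * pi * of_int j"
    unfolding assms(6) by (simp add: algebra_simps)
  also have "cis \<dots> = cis (pi / 6 * k3) * cis (pi / 6 * k4) * cis (2 * pi * of_int j)"
    by (simp only: cis_mult)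
  finally have c: "cis (pi / 6 * k1) * cis (pi / 6 * k2) = cis (pi / 6 * k3) * cis (pi / 6 * k4)"
    by simp
  have g: "of_int g1 * of_int g2 = (of_int g3 * of_int g4 :: complex)"
    using assms(7) by (metis of_int_mult)
  have "of_int g1 * of_int g2 \<noteq> (0 :: complex)" using assms(8) by simp
  moreover have "e1 * e2 = (cis (pi / 6 * k1) * cis (pi / 6 * k2)) * (v * v / (of_int g1 * of_int g2)) * (x1 * x2)"
    "e3 * e4 = (cis (pi / 6 * k3) * cis (pi / 6 * k4)) * (v * v / (of_int g3 * of_int g4)) * (x3 * x4)"
    unfolding assms(1-4) by simp_all
  ultimately show ?thesis unfolding c g using assms(5) by simp
qed

lemma denominator_nonzero:
  fixes C F :: int
  assumes "Im \<tau> > 0" "C \<noteq> 0"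
  shows "of_int C * \<tau> + of_int F \<noteq> 0"
proof
  assume "of_int C * \<tau> + of_int F = 0"
  then have "Im (of_int C * \<tau> + of_int F) = 0" by simp
  then show False using assms by simp
qed

text \<open>Pattern of all five moves: a map of determinant e takes the scaling \<delta>, a divisor
  of 42, to D = \<delta> e / gcd(\<delta>, e)^2 with content g = gcd(\<delta>, e). For e = 42 this
  is D = 42/\<delta>, which carries {1, 21} to {42, 2} and {3, 7} to {14, 6}.\<close>

lemma w_sq_move_0:
  assumes "Im \<tau> > 0"
  defines "z \<equiv> (of_int 0 * \<tau> + of_int (- 1)) / (of_int 42 * \<tau> + of_int 0)"
  shows "w_sq z = w_sq (2 * \<tau>)" "w_sq (2 * z) = w_sq \<tau>"
proof -
  have v: "of_int 42 * \<tau> + of_int 0 \<noteq> 0" by (rule denominator_nonzero[OF assms(1)]) simp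
  then have z: "z * (of_int 42 * \<tau> + of_int 0) = of_int 0 * \<tau> + of_int (- 1)"
    by (simp add: z_def)
  have e1: "eta_sq (of_int 1 * z) = cis (pi / 6 * of_int (- 3)) * ((of_int 42 * \<tau> + of_int 0) / of_int 1) * eta_sq (of_int 42 * \<tau>)"
    by (rule eta_sq_scaled_word[OF _ assms(1) _ _ z, of "[0]" "0" "0" "(- 1)" "1" "0"]) simp_all
  have e21: "eta_sq (of_int 21 * z) = cis (pi / 6 * of_int (- 3)) * ((of_int 42 * \<tau> + of_int 0) / of_int 21) * eta_sq (of_int 2 * \<tau>)"
    by (rule eta_sq_scaled_word[OF _ assms(1) _ _ z, of "[0]" "0" "0" "(- 1)" "1" "0"]) simp_all
  have e3: "eta_sq (of_int 3 * z) = cis (pi / 6 * of_int (- 3)) * ((of_int 42 * \<tau> + of_int 0) / of_int 3) * eta_sq (of_int 14 * \<tau>)"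
    by (rule eta_sq_scaled_word[OF _ assms(1) _ _ z, of "[0]" "0" "0" "(- 1)" "1" "0"]) simp_all
  have e7: "eta_sq (of_int 7 * z) = cis (pi / 6 * of_int (- 3)) * ((of_int 42 * \<tau> + of_int 0) / of_int 7) * eta_sq (of_int 6 * \<tau>)"
    by (rule eta_sq_scaled_word[OF _ assms(1) _ _ z, of "[0]" "0" "0" "(- 1)" "1" "0"]) simp_all
  have e2: "eta_sq (of_int 2 * z) = cis (pi / 6 * of_int (- 3)) * ((of_int 42 * \<tau> + of_int 0) / of_int 2) * eta_sq (of_int 21 * \<tau>)"
    by (rule eta_sq_scaled_word[OF _ assms(1) _ _ z, of "[0]" "0" "0" "(- 1)" "1" "0"]) simp_all
  have e42: "eta_sq (of_int 42 * z) = cis (pi / 6 * of_int (- 3)) * ((of_int 42 * \<tau> + of_int 0) / of_int 42) * eta_sq (of_int 1 * \<tau>)"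
    by (rule eta_sq_scaled_word[OF _ assms(1) _ _ z, of "[0]" "0" "0" "(- 1)" "1" "0"]) simp_all
  have e6: "eta_sq (of_int 6 * z) = cis (pi / 6 * of_int (- 3)) * ((of_int 42 * \<tau> + of_int 0) / of_int 6) * eta_sq (of_int 7 * \<tau>)"
    by (rule eta_sq_scaled_word[OF _ assms(1) _ _ z, of "[0]" "0" "0" "(- 1)" "1" "0"]) simp_all
  have e14: "eta_sq (of_int 14 * z) = cis (pi / 6 * of_int (- 3)) * ((of_int 42 * \<tau> + of_int 0) / of_int 14) * eta_sq (of_int 3 * \<tau>)"
    by (rule eta_sq_scaled_word[OF _ assms(1) _ _ z, of "[0]" "0" "0" "(- 1)" "1" "0"]) simp_all
  have "w_sq z = eta_sq (of_int 42 * \<tau>) * eta_sq (of_int 2 * \<tau>) /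
      (eta_sq (of_int 14 * \<tau>) * eta_sq (of_int 6 * \<tau>))"
    using eta_quotient_move[OF e1 e21 e3 e7 v, of "0"] by (simp add: w_sq_def)
  then show "w_sq z = w_sq (2 * \<tau>)" by (simp add: w_sq_def mult.commute)
  have "w_sq (2 * z) = eta_sq (of_int 21 * \<tau>) * eta_sq (of_int 1 * \<tau>) /
      (eta_sq (of_int 7 * \<tau>) * eta_sq (of_int 3 * \<tau>))"
    using eta_quotient_move[OF e2 e42 e6 e14 v, of "0"] by (simp add: w_sq_def)
  then show "w_sq (2 * z) = w_sq \<tau>" by (simp add: w_sq_def mult.commute)
qed

text \<open>For determinant 7 the scalings are paired as 1, 7 and 3, 21 and their doubles, so
  numerators and denominators change places.\<close>

lemma w_sq_move_1_6:
  assumes "Im \<tau> > 0"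
  defines "z \<equiv> (of_int (- 7) * \<tau> + of_int 1) / (of_int 42 * \<tau> + of_int (- 7))"
  shows "w_sq z = 1 / w_sq \<tau>" "w_sq (2 * z) = 1 / w_sq (2 * \<tau>)"
proof -
  have v: "of_int 42 * \<tau> + of_int (- 7) \<noteq> 0" by (rule denominator_nonzero[OF assms(1)]) simp
  then have z: "z * (of_int 42 * \<tau> + of_int (- 7)) = of_int (- 7) * \<tau> + of_int 1"
    by (simp add: z_def)
  \<comment> \<open>The words are continued fractions with minus signs of a/c, here -1/6 = 0 - 1/6;
    the final integer then fixes the second column.\<close>
  have e1: "eta_sq (of_int 1 * z) = cis (pi / 6 * of_int (- 1)) * ((of_int 42 * \<tau> + of_int (- 7)) / of_int 1) * eta_sq (of_int 7 * \<tau>)"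
    by (rule eta_sq_scaled_word[OF _ assms(1) _ _ z, of "[0, 6]" "(- 1)" "(- 1)" "1" "6" "(- 7)"]) simp_all
  have e21: "eta_sq (of_int 21 * z) = cis (pi / 6 * of_int (- 7)) * ((of_int 42 * \<tau> + of_int (- 7)) / of_int 7) * eta_sq (of_int 3 * \<tau>)"
    by (rule eta_sq_scaled_word[OF _ assms(1) _ _ z, of "[-3, 2]" "0" "(- 7)" "3" "2" "(- 1)"]) simp_all
  have e3: "eta_sq (of_int 3 * z) = cis (pi / 6 * of_int (- 7)) * ((of_int 42 * \<tau> + of_int (- 7)) / of_int 1) * eta_sq (of_int 21 * \<tau>)"
    by (rule eta_sq_scaled_word[OF _ assms(1) _ _ z, of "[0, 2]" "(- 3)" "(- 1)" "3" "2" "(- 7)"]) simp_all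
  have e7: "eta_sq (of_int 7 * z) = cis (pi / 6 * of_int (- 1)) * ((of_int 42 * \<tau> + of_int (- 7)) / of_int 7) * eta_sq (of_int 1 * \<tau>)"
    by (rule eta_sq_scaled_word[OF _ assms(1) _ _ z, of "[-1, 6]" "0" "(- 7)" "1" "6" "(- 1)"]) simp_all
  have e2: "eta_sq (of_int 2 * z) = cis (pi / 6 * of_int (- 5)) * ((of_int 42 * \<tau> + of_int (- 7)) / of_int 1) * eta_sq (of_int 14 * \<tau>)"
    by (rule eta_sq_scaled_word[OF _ assms(1) _ _ z, of "[0, 3]" "(- 2)" "(- 1)" "2" "3" "(- 7)"]) simp_all
  have e42: "eta_sq (of_int 42 * z) = cis (pi / 6 * of_int (- 11)) * ((of_int 42 * \<tau> + of_int (- 7)) / of_int 7) * eta_sq (of_int 6 * \<tau>)"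
    by (rule eta_sq_scaled_word[OF _ assms(1) _ _ z, of "[-7]" "(- 1)" "(- 7)" "6" "1" "(- 1)"]) simp_all
  have e6: "eta_sq (of_int 6 * z) = cis (pi / 6 * of_int (- 11)) * ((of_int 42 * \<tau> + of_int (- 7)) / of_int 1) * eta_sq (of_int 42 * \<tau>)"
    by (rule eta_sq_scaled_word[OF _ assms(1) _ _ z, of "[-1]" "(- 7)" "(- 1)" "6" "1" "(- 7)"]) simp_all
  have e14: "eta_sq (of_int 14 * z) = cis (pi / 6 * of_int (- 5)) * ((of_int 42 * \<tau> + of_int (- 7)) / of_int 7) * eta_sq (of_int 2 * \<tau>)"
    by (rule eta_sq_scaled_word[OF _ assms(1) _ _ z, of "[-2, 3]" "0" "(- 7)" "2" "3" "(- 1)"]) simp_all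
  have "w_sq z = eta_sq (of_int 7 * \<tau>) * eta_sq (of_int 3 * \<tau>) /
      (eta_sq (of_int 21 * \<tau>) * eta_sq (of_int 1 * \<tau>))"
    using eta_quotient_move[OF e1 e21 e3 e7 v, of "0"] by (simp add: w_sq_def)
  then show "w_sq z = 1 / w_sq \<tau>" by (simp add: w_sq_def mult.commute)
  have "w_sq (2 * z) = eta_sq (of_int 14 * \<tau>) * eta_sq (of_int 6 * \<tau>) /
      (eta_sq (of_int 42 * \<tau>) * eta_sq (of_int 2 * \<tau>))"
    using eta_quotient_move[OF e2 e42 e6 e14 v, of "0"] by (simp add: w_sq_def)
  then show "w_sq (2 * z) = 1 / w_sq (2 * \<tau>)" by (simp add: w_sq_def mult.commute)
qed

text \<open>Determinant 3 also exchanges numerators with denominators (1, 3 and 7, 21).\<close>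

lemma w_sq_move_3_14:
  assumes "Im \<tau> > 0"
  defines "z \<equiv> (of_int 9 * \<tau> + of_int (- 2)) / (of_int 42 * \<tau> + of_int (- 9))"
  shows "w_sq z = 1 / w_sq \<tau>" "w_sq (2 * z) = 1 / w_sq (2 * \<tau>)"
proof -
  have v: "of_int 42 * \<tau> + of_int (- 9) \<noteq> 0" by (rule denominator_nonzero[OF assms(1)]) simp
  then have z: "z * (of_int 42 * \<tau> + of_int (- 9)) = of_int 9 * \<tau> + of_int (- 2)"
    by (simp add: z_def)
  have e1: "eta_sq (of_int 1 * z) = cis (pi / 6 * of_int (- 18)) * ((of_int 42 * \<tau> + of_int (- 9)) / of_int 1) * eta_sq (of_int 3 * \<tau>)"
    by (rule eta_sq_scaled_word[OF _ assms(1) _ _ z, of "[0, -5, -3]" "(- 1)" "3" "(- 2)" "14" "(- 9)"]) simp_all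
  have e21: "eta_sq (of_int 21 * z) = cis (pi / 6 * of_int 0) * ((of_int 42 * \<tau> + of_int (- 9)) / of_int 3) * eta_sq (of_int 7 * \<tau>)"
    by (rule eta_sq_scaled_word[OF _ assms(1) _ _ z, of "[5, 2]" "(- 1)" "9" "(- 14)" "2" "(- 3)"]) simp_all
  have e3: "eta_sq (of_int 3 * z) = cis (pi / 6 * of_int 0) * ((of_int 42 * \<tau> + of_int (- 9)) / of_int 3) * eta_sq (of_int 1 * \<tau>)"
    by (rule eta_sq_scaled_word[OF _ assms(1) _ _ z, of "[1, 3, 5]" "0" "9" "(- 2)" "14" "(- 3)"]) simp_all
  have e7: "eta_sq (of_int 7 * z) = cis (pi / 6 * of_int (- 6)) * ((of_int 42 * \<tau> + of_int (- 9)) / of_int 1) * eta_sq (of_int 21 * \<tau>)"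
    by (rule eta_sq_scaled_word[OF _ assms(1) _ _ z, of "[2, 2]" "(- 4)" "3" "(- 14)" "2" "(- 9)"]) simp_all
  \<comment> \<open>The letters 0, 0 at the end of the word are two inversions in succession, that
    is the matrix -1. They correct the sign, which the continued fraction of 3/7 does not
    control.\<close>
  have e2: "eta_sq (of_int 2 * z) = cis (pi / 6 * of_int (- 15)) * ((of_int 42 * \<tau> + of_int (- 9)) / of_int 1) * eta_sq (of_int 6 * \<tau>)"
    by (rule eta_sq_scaled_word[OF _ assms(1) _ _ z, of "[0, -2, 3, 0, 0]" "(- 1)" "3" "(- 4)" "7" "(- 9)"]) simp_all
  have e42: "eta_sq (of_int 42 * z) = cis (pi / 6 * of_int 3) * ((of_int 42 * \<tau> + of_int (- 9)) / of_int 3) * eta_sq (of_int 14 * \<tau>)"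
    by (rule eta_sq_scaled_word[OF _ assms(1) _ _ z, of "[9]" "(- 3)" "9" "(- 28)" "1" "(- 3)"]) simp_all
  have e6: "eta_sq (of_int 6 * z) = cis (pi / 6 * of_int (- 15)) * ((of_int 42 * \<tau> + of_int (- 9)) / of_int 3) * eta_sq (of_int 2 * \<tau>)"
    by (rule eta_sq_scaled_word[OF _ assms(1) _ _ z, of "[1, -3, 2, 0, 0]" "0" "9" "(- 4)" "7" "(- 3)"]) simp_all
  have e14: "eta_sq (of_int 14 * z) = cis (pi / 6 * of_int (- 9)) * ((of_int 42 * \<tau> + of_int (- 9)) / of_int 1) * eta_sq (of_int 42 * \<tau>)"
    by (rule eta_sq_scaled_word[OF _ assms(1) _ _ z, of "[3]" "(- 9)" "3" "(- 28)" "1" "(- 9)"]) simp_all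
  have "w_sq z = eta_sq (of_int 3 * \<tau>) * eta_sq (of_int 7 * \<tau>) /
      (eta_sq (of_int 1 * \<tau>) * eta_sq (of_int 21 * \<tau>))"
    using eta_quotient_move[OF e1 e21 e3 e7 v, of "-1"] by (simp add: w_sq_def)
  then show "w_sq z = 1 / w_sq \<tau>" by (simp add: w_sq_def mult.commute)
  have "w_sq (2 * z) = eta_sq (of_int 6 * \<tau>) * eta_sq (of_int 14 * \<tau>) /
      (eta_sq (of_int 2 * \<tau>) * eta_sq (of_int 42 * \<tau>))"
    using eta_quotient_move[OF e2 e42 e6 e14 v, of "1"] by (simp add: w_sq_def)
  then show "w_sq (2 * z) = 1 / w_sq (2 * \<tau>)" by (simp add: w_sq_def mult.commute)
qed

text \<open>Determinant 14 carries {1, 21} to {14, 6} and {3, 7} to {42, 2}, so A and B are inverted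
  and exchanged at once.\<close>

lemma w_sq_move_1_3:
  assumes "Im \<tau> > 0"
  defines "z \<equiv> (of_int 14 * \<tau> + of_int (- 5)) / (of_int 42 * \<tau> + of_int (- 14))"
  shows "w_sq z = 1 / w_sq (2 * \<tau>)" "w_sq (2 * z) = 1 / w_sq \<tau>"
proof -
  have v: "of_int 42 * \<tau> + of_int (- 14) \<noteq> 0" by (rule denominator_nonzero[OF assms(1)]) simp
  then have z: "z * (of_int 42 * \<tau> + of_int (- 14)) = of_int 14 * \<tau> + of_int (- 5)"
    by (simp add: z_def)
  have e1: "eta_sq (of_int 1 * z) = cis (pi / 6 * of_int (- 20)) * ((of_int 42 * \<tau> + of_int (- 14)) / of_int 1) * eta_sq (of_int 14 * \<tau>)"
    by (rule eta_sq_scaled_word[OF _ assms(1) _ _ z, of "[0, -3, 0, 0]" "(- 5)" "1" "(- 5)" "3" "(- 14)"]) simp_all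
  have e21: "eta_sq (of_int 21 * z) = cis (pi / 6 * of_int 2) * ((of_int 42 * \<tau> + of_int (- 14)) / of_int 7) * eta_sq (of_int 6 * \<tau>)"
    by (rule eta_sq_scaled_word[OF _ assms(1) _ _ z, of "[7]" "(- 2)" "7" "(- 15)" "1" "(- 2)"]) simp_all
  have e3: "eta_sq (of_int 3 * z) = cis (pi / 6 * of_int (- 16)) * ((of_int 42 * \<tau> + of_int (- 14)) / of_int 1) * eta_sq (of_int 42 * \<tau>)"
    by (rule eta_sq_scaled_word[OF _ assms(1) _ _ z, of "[1]" "(- 14)" "1" "(- 15)" "1" "(- 14)"]) simp_all
  have e7: "eta_sq (of_int 7 * z) = cis (pi / 6 * of_int (- 14)) * ((of_int 42 * \<tau> + of_int (- 14)) / of_int 7) * eta_sq (of_int 2 * \<tau>)"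
    by (rule eta_sq_scaled_word[OF _ assms(1) _ _ z, of "[2, -3, 0, 0]" "(- 1)" "7" "(- 5)" "3" "(- 2)"]) simp_all
  have e2: "eta_sq (of_int 2 * z) = cis (pi / 6 * of_int (- 4)) * ((of_int 42 * \<tau> + of_int (- 14)) / of_int 2) * eta_sq (of_int 7 * \<tau>)"
    by (rule eta_sq_scaled_word[OF _ assms(1) _ _ z, of "[1, 3]" "(- 2)" "2" "(- 5)" "3" "(- 7)"]) simp_all
  have e42: "eta_sq (of_int 42 * z) = cis (pi / 6 * of_int 10) * ((of_int 42 * \<tau> + of_int (- 14)) / of_int 14) * eta_sq (of_int 3 * \<tau>)"
    by (rule eta_sq_scaled_word[OF _ assms(1) _ _ z, of "[14]" "(- 1)" "14" "(- 15)" "1" "(- 1)"]) simp_all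
  have e6: "eta_sq (of_int 6 * z) = cis (pi / 6 * of_int (- 8)) * ((of_int 42 * \<tau> + of_int (- 14)) / of_int 2) * eta_sq (of_int 21 * \<tau>)"
    by (rule eta_sq_scaled_word[OF _ assms(1) _ _ z, of "[2]" "(- 7)" "2" "(- 15)" "1" "(- 7)"]) simp_all
  have e14: "eta_sq (of_int 14 * z) = cis (pi / 6 * of_int 2) * ((of_int 42 * \<tau> + of_int (- 14)) / of_int 14) * eta_sq (of_int 1 * \<tau>)"
    by (rule eta_sq_scaled_word[OF _ assms(1) _ _ z, of "[5, 3]" "0" "14" "(- 5)" "3" "(- 1)"]) simp_all
  have "w_sq z = eta_sq (of_int 14 * \<tau>) * eta_sq (of_int 6 * \<tau>) /
      (eta_sq (of_int 42 * \<tau>) * eta_sq (of_int 2 * \<tau>))"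
    using eta_quotient_move[OF e1 e21 e3 e7 v, of "1"] by (simp add: w_sq_def)
  then show "w_sq z = 1 / w_sq (2 * \<tau>)" by (simp add: w_sq_def mult.commute)
  have "w_sq (2 * z) = eta_sq (of_int 7 * \<tau>) * eta_sq (of_int 3 * \<tau>) /
      (eta_sq (of_int 21 * \<tau>) * eta_sq (of_int 1 * \<tau>))"
    using eta_quotient_move[OF e2 e42 e6 e14 v, of "1"] by (simp add: w_sq_def)
  then show "w_sq (2 * z) = 1 / w_sq \<tau>" by (simp add: w_sq_def mult.commute)
qed

text \<open>Determinant 21 pairs 1 with 21 and 3 with 7, within the numerator and within the
  denominator.\<close>

lemma w_sq_move_1_2:
  assumes "Im \<tau> > 0"
  defines "z \<equiv> (of_int 21 * \<tau> + of_int (- 11)) / (of_int 42 * \<tau> + of_int (- 21))"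
  shows "w_sq z = w_sq \<tau>" "w_sq (2 * z) = w_sq (2 * \<tau>)"
proof -
  have v: "of_int 42 * \<tau> + of_int (- 21) \<noteq> 0" by (rule denominator_nonzero[OF assms(1)]) simp
  then have z: "z * (of_int 42 * \<tau> + of_int (- 21)) = of_int 21 * \<tau> + of_int (- 11)"
    by (simp add: z_def)
  have e1: "eta_sq (of_int 1 * z) = cis (pi / 6 * of_int (- 13)) * ((of_int 42 * \<tau> + of_int (- 21)) / of_int 1) * eta_sq (of_int 21 * \<tau>)"
    by (rule eta_sq_scaled_word[OF _ assms(1) _ _ z, of "[1, 2]" "(- 10)" "1" "(- 11)" "2" "(- 21)"]) simp_all
  have e21: "eta_sq (of_int 21 * z) = cis (pi / 6 * of_int 7) * ((of_int 42 * \<tau> + of_int (- 21)) / of_int 21) * eta_sq (of_int 1 * \<tau>)"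
    by (rule eta_sq_scaled_word[OF _ assms(1) _ _ z, of "[11, 2]" "0" "21" "(- 11)" "2" "(- 1)"]) simp_all
  have e3: "eta_sq (of_int 3 * z) = cis (pi / 6 * of_int (- 5)) * ((of_int 42 * \<tau> + of_int (- 21)) / of_int 3) * eta_sq (of_int 7 * \<tau>)"
    by (rule eta_sq_scaled_word[OF _ assms(1) _ _ z, of "[2, 2]" "(- 3)" "3" "(- 11)" "2" "(- 7)"]) simp_all
  have e7: "eta_sq (of_int 7 * z) = cis (pi / 6 * of_int (- 1)) * ((of_int 42 * \<tau> + of_int (- 21)) / of_int 7) * eta_sq (of_int 3 * \<tau>)"
    by (rule eta_sq_scaled_word[OF _ assms(1) _ _ z, of "[4, 2]" "(- 1)" "7" "(- 11)" "2" "(- 3)"]) simp_all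
  have e2: "eta_sq (of_int 2 * z) = cis (pi / 6 * of_int (- 23)) * ((of_int 42 * \<tau> + of_int (- 21)) / of_int 1) * eta_sq (of_int 42 * \<tau>)"
    by (rule eta_sq_scaled_word[OF _ assms(1) _ _ z, of "[1]" "(- 21)" "1" "(- 22)" "1" "(- 21)"]) simp_all
  have e42: "eta_sq (of_int 42 * z) = cis (pi / 6 * of_int 17) * ((of_int 42 * \<tau> + of_int (- 21)) / of_int 21) * eta_sq (of_int 2 * \<tau>)"
    by (rule eta_sq_scaled_word[OF _ assms(1) _ _ z, of "[21]" "(- 1)" "21" "(- 22)" "1" "(- 1)"]) simp_all
  have e6: "eta_sq (of_int 6 * z) = cis (pi / 6 * of_int (- 7)) * ((of_int 42 * \<tau> + of_int (- 21)) / of_int 3) * eta_sq (of_int 14 * \<tau>)"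
    by (rule eta_sq_scaled_word[OF _ assms(1) _ _ z, of "[3]" "(- 7)" "3" "(- 22)" "1" "(- 7)"]) simp_all
  have e14: "eta_sq (of_int 14 * z) = cis (pi / 6 * of_int 1) * ((of_int 42 * \<tau> + of_int (- 21)) / of_int 7) * eta_sq (of_int 6 * \<tau>)"
    by (rule eta_sq_scaled_word[OF _ assms(1) _ _ z, of "[7]" "(- 3)" "7" "(- 22)" "1" "(- 3)"]) simp_all
  have "w_sq z = eta_sq (of_int 21 * \<tau>) * eta_sq (of_int 1 * \<tau>) /
      (eta_sq (of_int 7 * \<tau>) * eta_sq (of_int 3 * \<tau>))"
    using eta_quotient_move[OF e1 e21 e3 e7 v, of "0"] by (simp add: w_sq_def)
  then show "w_sq z = w_sq \<tau>" by (simp add: w_sq_def mult.commute)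
  have "w_sq (2 * z) = eta_sq (of_int 42 * \<tau>) * eta_sq (of_int 2 * \<tau>) /
      (eta_sq (of_int 14 * \<tau>) * eta_sq (of_int 6 * \<tau>))"
    using eta_quotient_move[OF e2 e42 e6 e14 v, of "0"] by (simp add: w_sq_def)
  then show "w_sq (2 * z) = w_sq (2 * \<tau>)" by (simp add: w_sq_def mult.commute)
qed

section \<open>The invariant function\<close>

definition modular_poly :: "complex \<Rightarrow> complex \<Rightarrow> complex" where
  "modular_poly a b = (a + b) ^ 3 - a * b * (1 - a) * (1 - b)"

text \<open>
  Squaring avoids the half-integral power \<open>(a b)\<^bsup>3/2\<^esup>\<close> by which \<open>modular_poly a b\<close> would have to be
  divided to become invariant under \<open>(a, b) \<mapsto> (1/a, 1/b)\<close>.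
\<close>

definition defect_of :: "complex \<Rightarrow> complex \<Rightarrow> complex" where
  "defect_of a b = modular_poly a b ^ 2 / (a * b) ^ 3"

definition defect :: "complex \<Rightarrow> complex" where
  "defect \<tau> = defect_of (w_sq \<tau>) (w_sq (2 * \<tau>))"

lemma defect_of_commute: "defect_of b a = defect_of a b"
  by (simp add: defect_of_def modular_poly_def algebra_simps)

lemma defect_of_inverse:
  assumes "a \<noteq> 0" "b \<noteq> 0"
  shows "defect_of (1 / a) (1 / b) = defect_of a b"
proof -
  have "modular_poly (1 / a) (1 / b) = modular_poly a b / (a * b) ^ 3"
    using assms by (simp add: modular_poly_def field_simps) algebra
  then have "defect_of (1 / a) (1 / b) = (modular_poly a b / (a * b) ^ 3) ^ 2 / (1 / a * (1 / b)) ^ 3"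
    by (simp only: defect_of_def)
  also have "\<dots> = defect_of a b"
    using assms by (simp add: defect_of_def power_divide field_simps)
  finally show ?thesis .
qed

text \<open>What is left of \<open>w_sq\<close> without its leading power of q. The fractional
  exponents add up to (1 + 21 - 3 - 7)/12 = 1, so exactly one factor q is split off.\<close>

definition u_nome :: "complex \<Rightarrow> complex" where
  "u_nome q = (f_minus q * f_minus (q ^ 21) / (f_minus (q ^ 3) * f_minus (q ^ 7))) ^ 2"

lemma w_sq_eq_nome:
  "w_sq \<tau> = exp (2 * pi * \<i> * \<tau>) * u_nome (exp (2 * pi * \<i> * \<tau>))"
proof -
  define q where "q = exp (2 * pi * \<i> * \<tau>)"
  define p where "p = exp (2 * pi * \<i> * \<tau> / 12)"
  have E: "eta_sq (of_nat n * \<tau>) = p ^ n * f_minus (q ^ n) ^ 2" for n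
  proof -
    have "exp (2 * pi * \<i> * (of_nat n * \<tau>)) = q ^ n"
      unfolding q_def exp_of_nat_mult[symmetric] by (simp add: mult_ac)
    moreover have "exp (2 * pi * \<i> * (of_nat n * \<tau>) / 12) = p ^ n"
      unfolding p_def exp_of_nat_mult[symmetric] by (simp add: mult_ac)
    ultimately show ?thesis unfolding eta_sq_def by simp
  qed
  have p: "p ^ 12 = q" "p \<noteq> 0"
    unfolding p_def q_def exp_of_nat_mult[symmetric] by (simp_all add: mult_ac)
  have "w_sq \<tau> = p * f_minus q ^ 2 * (p ^ 21 * f_minus (q ^ 21) ^ 2) /
      (p ^ 3 * f_minus (q ^ 3) ^ 2 * (p ^ 7 * f_minus (q ^ 7) ^ 2))"
    using E[of 1] E[of 21] E[of 3] E[of 7] by (simp add: w_sq_def)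
  also have "\<dots> = (p * p ^ 21) / (p ^ 3 * p ^ 7) * u_nome q"
    unfolding u_nome_def power_mult_distrib power_divide times_divide_times_eq by (simp only: mult_ac)
  also have "p * p ^ 21 = q * (p ^ 3 * p ^ 7)"
    unfolding p(1)[symmetric] by (simp flip: power_add power_Suc)
  finally show ?thesis using p(2) by (simp add: q_def)
qed

lemma nome_double: "exp (2 * pi * \<i> * (2 * \<tau>)) = exp (2 * pi * \<i> * \<tau>) ^ 2"
proof -
  have "2 * pi * \<i> * (2 * \<tau>) = 2 * (2 * pi * \<i> * \<tau>)" by simp
  then show ?thesis by (simp only: exp_double)
qed

lemma norm_power_less_one: "norm (q :: complex) < 1 \<Longrightarrow> n > 0 \<Longrightarrow> norm (q ^ n) < 1"
  by (simp add: norm_power power_less_one_iff)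

lemma u_nome_nonzero: "norm q < 1 \<Longrightarrow> u_nome q \<noteq> 0"
  by (simp add: u_nome_def f_minus_nonzero norm_power_less_one)

lemma w_sq_nonzero: "Im \<tau> > 0 \<Longrightarrow> w_sq \<tau> \<noteq> 0"
  unfolding w_sq_eq_nome using u_nome_nonzero[OF nome_in_ball] by simp

definition defect_nome :: "complex \<Rightarrow> complex" where
  "defect_nome q = defect_of (q * u_nome q) (q\<^sup>2 * u_nome (q\<^sup>2))"

lemma defect_eq_nome: "defect \<tau> = defect_nome (exp (2 * pi * \<i> * \<tau>))"
  unfolding defect_def defect_nome_def w_sq_eq_nome nome_double ..

lemma defect_add_int: "defect (\<tau> + of_int n) = defect \<tau>"
proof -
  have "exp (2 * pi * \<i> * (\<tau> + of_int n)) = exp (2 * pi * \<i> * \<tau>) * exp (\<i> * (2 * pi * of_int n))"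
    by (simp add: exp_add[symmetric] algebra_simps)
  also have "exp (\<i> * (2 * pi * of_int n)) = cis (2 * pi * n)" by (simp add: cis_conv_exp)
  finally show ?thesis by (simp add: defect_eq_nome)
qed

text \<open>The expansions in q have real coefficients. As the maximum principle needs only the
  modulus, this halves the strip that the isometric circles have to cover.\<close>

lemma defect_reflect: "defect (- cnj \<tau>) = cnj (defect \<tau>)"
proof -
  have "exp (2 * pi * \<i> * (- cnj \<tau>)) = cnj (exp (2 * pi * \<i> * \<tau>))"
    by (simp add: exp_cnj)
  moreover have u: "cnj (u_nome q) = u_nome (cnj q)" for q
    unfolding u_nome_def by (simp add: f_minus_cnj[symmetric])
  have "defect_nome (cnj q) = cnj (defect_nome q)" for q
    unfolding defect_nome_def defect_of_def modular_poly_def by (simp add: u)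
  ultimately show ?thesis by (simp add: defect_eq_nome)
qed

lemma defect_holomorphic: "defect holomorphic_on {z. Im z > 0}"
proof -
  have "(\<lambda>\<tau>. w_sq (of_real c * \<tau>)) holomorphic_on {z. Im z > 0}" if "c > 0" for c :: real
    unfolding w_sq_def using that
    by (intro holomorphic_intros eta_sq_holomorphic) (auto simp: eta_sq_nonzero)
  from this[of 1] this[of 2] show ?thesis
    unfolding defect_def defect_of_def modular_poly_def
    by (intro holomorphic_intros) (auto simp: w_sq_nonzero)
qed

section \<open>Raising points of the upper half plane\<close>

lemma Im_move:
  fixes A B C F :: int
  shows "Im ((of_int A * \<tau> + of_int B) / (of_int C * \<tau> + of_int F)) =
    of_int (A * F - B * C) * Im \<tau> / ((C * Re \<tau> + F)\<^sup>2 + (C * Im \<tau>)\<^sup>2)"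
  by (simp add: Im_divide algebra_simps)

text \<open>The new imaginary part is Im \<tau> times the determinant over |42 \<tau> + F|^2. Asking
  for 9/10 of the determinant instead of the determinant itself gives a uniform gain, so finitely
  many moves reach a fixed height.\<close>

lemma Im_move_ge:
  fixes A B F :: int
  assumes "Im \<tau> > 0" "(42 * Re \<tau> + F)\<^sup>2 + (42 * Im \<tau>)\<^sup>2 \<le> 9 / 10 * of_int (A * F - B * 42)"
  shows "10 / 9 * Im \<tau> \<le> Im ((of_int A * \<tau> + of_int B) / (of_int 42 * \<tau> + of_int F))"
proof -
  have "0 < (42 * Re \<tau> + F)\<^sup>2 + (42 * Im \<tau>)\<^sup>2"
    using assms(1) by (simp add: add_nonneg_pos)
  moreover have "10 / 9 * Im \<tau> * ((42 * Re \<tau> + F)\<^sup>2 + (42 * Im \<tau>)\<^sup>2) \<le> of_int (A * F - B * 42) * Im \<tau>"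
    using mult_left_mono[OF assms(2), of "10 / 9 * Im \<tau>"] assms(1) by (simp add: algebra_simps)
  ultimately show ?thesis unfolding Im_move by (simp add: pos_le_divide_eq)
qed

lemma square_le_if_abs_le: "\<bar>x\<bar> \<le> c \<Longrightarrow> x\<^sup>2 \<le> c\<^sup>2" for x c :: real
  by (metis abs_ge_zero power2_abs power_mono)

text \<open>
  The fractional linear maps used here represent the Atkin--Lehner involutions of level 42 of
  determinant 42, 7, 3, 14 and 21. Their isometric circles are centred at 0, 1/6, 3/14, 1/3 and 1/2 and cover
  the strip \<open>0 \<le> Re \<tau> \<le> 1/2\<close> up to height 1/100; inside its circle such a map raises the imaginary part.
\<close>

lemma defect_move_half:
  assumes "Im \<tau> > 0" "Im \<tau> < 1 / 100" "0 \<le> Re \<tau>" "Re \<tau> \<le> 1 / 2"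
  shows "\<exists>\<tau>'. 10 / 9 * Im \<tau> \<le> Im \<tau>' \<and> defect \<tau>' = defect \<tau>"
proof -
  have y: "(42 * Im \<tau>)\<^sup>2 \<le> (42 / 100)\<^sup>2" using assms by (intro square_le_if_abs_le) auto
  have nz: "w_sq \<tau> \<noteq> 0" "w_sq (2 * \<tau>) \<noteq> 0" using assms w_sq_nonzero[of \<tau>] w_sq_nonzero[of "2 * \<tau>"] by auto
  note inv = defect_of_inverse[OF nz] defect_of_commute[of "w_sq (2 * \<tau>)" "w_sq \<tau>"]
    trans[OF defect_of_commute[of "1 / w_sq (2 * \<tau>)" "1 / w_sq \<tau>"] defect_of_inverse[OF nz]]
  have lift: "\<exists>\<tau>'. 10 / 9 * Im \<tau> \<le> Im \<tau>' \<and> defect \<tau>' = defect \<tau>"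
    if "42 * Re \<tau> + F \<le> r" "- r \<le> 42 * Re \<tau> + F" "r\<^sup>2 + (42 / 100)\<^sup>2 \<le> 9 / 10 * of_int (A * F - B * 42)"
      "defect ((of_int A * \<tau> + of_int B) / (of_int 42 * \<tau> + of_int F)) = defect \<tau>" for A B F :: int and r
  proof -
    have "(42 * Re \<tau> + F)\<^sup>2 + (42 * Im \<tau>)\<^sup>2 \<le> 9 / 10 * of_int (A * F - B * 42)"
      using square_le_if_abs_le[of "42 * Re \<tau> + F" r] that(1-3) y by (simp add: abs_le_iff)
    from Im_move_ge[OF assms(1) this] that(4) show ?thesis by blast
  qed
  \<comment> \<open>A circle of determinant e has radius sqrt e / 42, and the breakpoints leave room
    for the factor 9/10. Those around 1/6 and 1/3 do not meet; the third interval contains the gap,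
    which the circle around 3/14 covers. The fourth case is the tightest: 12.25 + 0.1764 against
    12.6.\<close>
  consider "Re \<tau> \<le> 14 / 100" | "14 / 100 \<le> Re \<tau>" "Re \<tau> \<le> 22 / 100" | "22 / 100 \<le> Re \<tau>" "Re \<tau> \<le> 1 / 4"
    | "1 / 4 \<le> Re \<tau>" "Re \<tau> \<le> 4 / 10" | "4 / 10 \<le> Re \<tau>" by linarith
  then show ?thesis
  proof cases
    case 1
    show ?thesis
      by (rule lift[of 0 "588 / 100" 0 "- 1"])
        (use 1 assms in \<open>auto simp: power2_eq_square abs_le_iff defect_def w_sq_move_0[OF assms(1), simplified] inv\<close>)
  next
    case 2
    show ?thesis
      by (rule lift[of "- 7" "224 / 100" "- 7" 1])
        (use 2 assms in \<open>auto simp: power2_eq_square abs_le_iff defect_def w_sq_move_1_6[OF assms(1), simplified] inv\<close>)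
  next
    case 3
    show ?thesis
      by (rule lift[of "- 9" "3 / 2" 9 "- 2"])
        (use 3 assms in \<open>auto simp: power2_eq_square abs_le_iff defect_def w_sq_move_3_14[OF assms(1), simplified] inv\<close>)
  next
    case 4
    show ?thesis
      by (rule lift[of "- 14" "7 / 2" 14 "- 5"])
        (use 4 assms in \<open>auto simp: power2_eq_square abs_le_iff defect_def w_sq_move_1_3[OF assms(1), simplified] inv\<close>)
  next
    case 5
    show ?thesis
      by (rule lift[of "- 21" "42 / 10" 21 "- 11"])
        (use 5 assms in \<open>auto simp: power2_eq_square abs_le_iff defect_def w_sq_move_1_2[OF assms(1), simplified] inv\<close>)
  qed
qed

lemma defect_move:
  assumes "Im \<tau> > 0" "Im \<tau> < 1 / 100"
  shows "\<exists>\<tau>'. 10 / 9 * Im \<tau> \<le> Im \<tau>' \<and> norm (defect \<tau>') = norm (defect \<tau>)"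
proof -
  define z where "z = \<tau> + of_int (- \<lfloor>Re \<tau>\<rfloor>)"
  have z: "Im z = Im \<tau>" "0 \<le> Re z" "Re z \<le> 1" "defect z = defect \<tau>"
    unfolding z_def defect_add_int by (auto, linarith+)
  show ?thesis
  proof (cases "Re z \<le> 1 / 2")
    case True
    then show ?thesis using defect_move_half[of z] z assms by auto
  next
    case False
    define z' where "z' = - cnj z + of_int 1"
    have "defect z' = cnj (defect \<tau>)" unfolding z'_def defect_add_int defect_reflect z(4) ..
    then show ?thesis using defect_move_half[of z'] False z assms by (auto simp: z'_def)
  qed
qed

lemma defect_reduce:
  assumes "Im \<tau> > 0"
  obtains \<tau>' where "0 \<le> Re \<tau>'" "Re \<tau>' \<le> 1" "1 / 100 \<le> Im \<tau>'" "norm (defect \<tau>') = norm (defect \<tau>)"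
proof -
  have *: "\<exists>\<tau>'. 1 / 100 \<le> Im \<tau>' \<and> norm (defect \<tau>') = norm (defect \<tau>)"
    if "Im \<tau> > 0" "(9 / 10) ^ n * (1 / 100) \<le> Im \<tau>" for n \<tau>
    using that
  proof (induction n arbitrary: \<tau>)
    case 0
    then show ?case by (intro exI[of _ \<tau>]) simp
  next
    case (Suc n)
    show ?case
    proof (cases "Im \<tau> < 1 / 100")
      case True
      then obtain z where z: "10 / 9 * Im \<tau> \<le> Im z" "norm (defect z) = norm (defect \<tau>)"
        using defect_move Suc.prems by blast
      moreover have "(9 / 10) ^ n * (1 / 100) \<le> Im z" "Im z > 0" using z(1) Suc.prems by auto
      ultimately show ?thesis using Suc.IH by metis
    qed (intro exI[of _ \<tau>], simp)
  qed
  \<comment> \<open>With a gain of 10/9 per move, n moves suffice to climb from Im \<tau> to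
    1/100.\<close>
  obtain n where "(9 / 10 :: real) ^ n < 100 * Im \<tau>"
    using real_arch_pow_inv[of "100 * Im \<tau>" "9 / 10"] assms by auto
  then obtain z where z: "1 / 100 \<le> Im z" "norm (defect z) = norm (defect \<tau>)"
    using *[OF assms, of n] by auto
  define \<tau>' where "\<tau>' = z + of_int (- \<lfloor>Re z\<rfloor>)"
  have "Im \<tau>' = Im z" "0 \<le> Re \<tau>'" "Re \<tau>' \<le> 1" "defect \<tau>' = defect z"
    unfolding \<tau>'_def defect_add_int by (auto, linarith+)
  then show ?thesis using z that by metis
qed

section \<open>Order of vanishing at the cusp\<close>

lemma f_minus_deriv_0: "(f_minus has_field_derivative - 1) (at 0)"
proof -
  \<comment> \<open>Except for k = 0 and k = 1 the pentagonal exponent is at least |k| + 1. After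
    |q|^2 is split off, |q| \<le> 1/2 leaves at most (1/2)^(|k| - 1), which is
    \<open>b k\<close>.\<close>
  define b :: "int \<Rightarrow> real" where "b k = 2 * (1 / 2) ^ nat \<bar>k\<bar>" for k
  have b: "b summable_on UNIV"
    unfolding b_def by (intro summable_on_cmult_right summable_on_int_power_abs) auto
  define C where "C = infsum b (- {0, 1})"
  have bound: "norm (f_minus q - 1 + q) \<le> norm q ^ 2 * C" if q: "norm q \<le> 1 / 2" for q
  proof -
    have sum: "(pent q has_sum f_minus q) UNIV" using q by (intro pent_has_sum) auto
    have "(pent q has_sum (\<Sum>k\<in>{0, 1}. pent q k)) {0, 1}" by (rule has_sum_finite) simp
    moreover have "(\<Sum>k\<in>{0, 1}. pent q k) = 1 - q" by (simp add: pent_def)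
    ultimately have "(pent q has_sum (f_minus q - (1 - q))) (- {0, 1})"
      using has_sum_Diff[OF sum, of "{0, 1}" "1 - q"] by (simp add: Compl_eq_Diff_UNIV)
    moreover have "f_minus q - (1 - q) = f_minus q - 1 + q" by simp
    ultimately have tail: "(pent q has_sum (f_minus q - 1 + q)) (- {0, 1})" by (simp only:)
    have "(b has_sum C) (- {0, 1})"
      unfolding C_def by (intro has_sum_infsum summable_on_subset_banach[OF b]) auto
    then have major: "((\<lambda>k. norm q ^ 2 * b k) has_sum norm q ^ 2 * C) (- {0, 1})"
      by (rule has_sum_cmult_right)
    have le: "norm (pent q k) \<le> norm q ^ 2 * b k" if "k \<in> - {0, 1}" for k
    proof -
      define m where "m = nat \<bar>k\<bar> - 1"
      have m: "nat \<bar>k\<bar> = Suc m" using that by (auto simp: m_def)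
      have "int m + 2 \<le> k * (3 * k - 1) div 2"
      proof -
        have "2 * (\<bar>k\<bar> + 1) \<le> k * (3 * k - 1)"
        proof (cases "k \<ge> 2")
          case True
          then have "k * 5 \<le> k * (3 * k - 1)" by (intro mult_left_mono) auto
          moreover have "2 * (\<bar>k\<bar> + 1) \<le> k * 5" using True by simp
          ultimately show ?thesis by (rule order_trans[rotated])
        next
          case False
          then have "k \<le> - 1" using that by auto
          then have "(- k) * 4 \<le> (- k) * (- (3 * k - 1))" by (intro mult_left_mono) auto
          also have "(- k) * (- (3 * k - 1)) = k * (3 * k - 1)" by (simp add: algebra_simps)
          finally have "(- k) * 4 \<le> k * (3 * k - 1)" .
          moreover have "2 * (\<bar>k\<bar> + 1) \<le> (- k) * 4" using \<open>k \<le> - 1\<close> by simp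
          ultimately show ?thesis by (rule order_trans[rotated])
        qed
        then have "2 * (\<bar>k\<bar> + 1) div 2 \<le> k * (3 * k - 1) div 2" by (rule zdiv_mono1) simp
        moreover have "\<bar>k\<bar> = int m + 1" using m by linarith
        ultimately show ?thesis by simp
      qed
      then obtain e where e: "k * (3 * k - 1) div 2 = int (e + (m + 2))"
        by (metis add.commute nonneg_int_cases le_add_diff_inverse2 of_nat_add of_nat_numeral diff_ge_0_iff_ge)
      have "norm (pent q k) = norm q ^ (e + (m + 2))"
        unfolding pent_def e power_int_of_nat by (simp add: norm_mult norm_power norm_power_int)
      also have "\<dots> \<le> norm q ^ (m + 2)" using q by (intro power_decreasing) auto
      also have "\<dots> = norm q ^ 2 * norm q ^ m" by (simp add: power_add power2_eq_square)
      also have "\<dots> \<le> norm q ^ 2 * (1 / 2) ^ m" using q by (intro mult_left_mono power_mono) auto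
      finally show ?thesis unfolding b_def m by simp
    qed
    show ?thesis by (rule norm_infsum_le[OF tail major le])
  qed
  have C: "0 \<le> C" unfolding C_def b_def by (rule infsum_nonneg) simp
  have "((\<lambda>q. (f_minus q - f_minus 0) / (q - 0) - (- 1)) \<longlongrightarrow> 0) (at 0)"
  proof (rule Lim_null_comparison)
    show "((\<lambda>q. norm q * C) \<longlongrightarrow> 0) (at (0 :: complex))"
      by (auto intro!: tendsto_eq_intros)
    have "norm ((f_minus q - f_minus 0) / (q - 0) - (- 1)) \<le> norm q * C"
      if "q \<noteq> 0" "norm q < 1 / 2" for q
    proof -
      have "norm ((f_minus q - f_minus 0) / (q - 0) - (- 1)) = norm (f_minus q - 1 + q) / norm q"
        using that by (simp add: f_minus_0 norm_divide[symmetric] field_simps)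
      also have "\<dots> \<le> norm q * C"
        using bound[of q] that by (simp add: divide_le_eq power2_eq_square algebra_simps)
      finally show ?thesis .
    qed
    then show "\<forall>\<^sub>F q in at 0. norm ((f_minus q - f_minus 0) / (q - 0) - (- 1)) \<le> norm q * C"
      unfolding eventually_at by (intro exI[of _ "1 / 2"]) auto
  qed
  then show ?thesis unfolding has_field_derivative_iff by (rule LIM_zero_cancel)
qed

definition reduced_poly :: "complex \<Rightarrow> complex" where
  "reduced_poly q = (u_nome q + q * u_nome (q\<^sup>2)) ^ 3
    - u_nome q * u_nome (q\<^sup>2) * (1 - q * u_nome q) * (1 - q\<^sup>2 * u_nome (q\<^sup>2))"

lemma modular_poly_eq_reduced: "modular_poly (q * u_nome q) (q\<^sup>2 * u_nome (q\<^sup>2)) = q ^ 3 * reduced_poly q"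
  unfolding modular_poly_def reduced_poly_def by (simp add: power2_eq_square power3_eq_cube algebra_simps)

lemma f_minus_power_holomorphic:
  assumes "n > 0"
  shows "(\<lambda>q. f_minus (q ^ n)) holomorphic_on ball 0 1"
  by (rule holomorphic_on_compose_gen[OF _ f_minus_holomorphic, unfolded o_def])
    (use assms norm_power_less_one in \<open>auto intro!: holomorphic_intros\<close>)

lemma u_nome_holomorphic: "u_nome holomorphic_on ball 0 1"
  unfolding u_nome_def
  by (intro holomorphic_intros f_minus_holomorphic f_minus_power_holomorphic)
    (auto simp: f_minus_nonzero norm_power_less_one)

lemma u_nome_square_holomorphic: "(\<lambda>q. u_nome (q\<^sup>2)) holomorphic_on ball 0 1"
  by (rule holomorphic_on_compose_gen[OF _ u_nome_holomorphic, unfolded o_def])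
    (use norm_power_less_one in \<open>auto intro!: holomorphic_intros\<close>)

lemma u_nome_0: "u_nome 0 = 1"
  by (simp add: u_nome_def f_minus_0)

lemma f_minus_power_deriv_0:
  assumes "n > 1"
  shows "((\<lambda>q. f_minus (q ^ n)) has_field_derivative 0) (at 0)"
proof -
  have "((\<lambda>q :: complex. q ^ n) has_field_derivative 0) (at 0)"
    using assms by (auto intro!: derivative_eq_intros)
  moreover have "(f_minus has_field_derivative - 1) (at (0 ^ n))"
    using assms f_minus_deriv_0 by (simp add: power_0_left)
  ultimately show ?thesis using DERIV_chain2[of f_minus "- 1" "\<lambda>q. q ^ n" 0 0 UNIV] by simp
qed

lemma u_nome_deriv_0: "(u_nome has_field_derivative - 2) (at 0)"
  unfolding u_nome_def
  by (rule derivative_eq_intros f_minus_deriv_0 f_minus_power_deriv_0 | simp add: f_minus_0)+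

lemma u_nome_square_deriv_0: "((\<lambda>q. u_nome (q\<^sup>2)) has_field_derivative 0) (at 0)"
proof -
  have "((\<lambda>q :: complex. q\<^sup>2) has_field_derivative 0) (at 0)"
    by (auto intro!: derivative_eq_intros)
  then show ?thesis using DERIV_chain2[of u_nome "- 2" "\<lambda>q. q\<^sup>2" 0 0 UNIV] u_nome_deriv_0 by simp
qed

text \<open>With \<open>u_nome q\<close> = 1 - 2q + ..., both halves of \<open>reduced_poly\<close>
  are 1 - 3q + .... This and the vanishing constant term are all that is used of the
  expansions.\<close>

lemma reduced_poly_deriv_0: "(reduced_poly has_field_derivative 0) (at 0)"
  unfolding reduced_poly_def
  by (rule derivative_eq_intros u_nome_deriv_0 u_nome_square_deriv_0 refl | simp add: u_nome_0)+

lemma reduced_poly_holomorphic: "reduced_poly holomorphic_on ball 0 1"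
  unfolding reduced_poly_def by (intro holomorphic_intros u_nome_holomorphic u_nome_square_holomorphic)

text \<open>Taylor's formula with two vanishing coefficients; the second derivative is bounded on
  the compact disc of radius 1/2.\<close>

lemma reduced_poly_bound:
  obtains C where "\<And>q. norm q \<le> 1 / 2 \<Longrightarrow> norm (reduced_poly q) \<le> C * norm q ^ 2"
proof -
  let ?f = "\<lambda>i. (deriv ^^ i) reduced_poly"
  have hol: "?f i holomorphic_on ball 0 1" for i
    by (intro holomorphic_higher_deriv reduced_poly_holomorphic) auto
  have "continuous_on (cball 0 (1 / 2)) (?f 2)"
    by (rule continuous_on_subset[OF holomorphic_on_imp_continuous_on[OF hol]]) auto
  then have "bounded (?f 2 ` cball 0 (1 / 2))"
    by (intro compact_imp_bounded compact_continuous_image) auto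
  then obtain C where C: "\<And>q. q \<in> cball 0 (1 / 2) \<Longrightarrow> norm (?f 2 q) \<le> C"
    unfolding bounded_iff by blast
  have "norm (reduced_poly q) \<le> C * norm q ^ 2" if "norm q \<le> 1 / 2" for q
  proof -
    have "norm (?f 0 q - (\<Sum>i\<le>1. ?f i 0 * (q - 0) ^ i / fact i)) \<le> C * norm (q - 0) ^ Suc 1 / fact 1"
    proof (rule complex_Taylor[where S = "cball 0 (1 / 2)"])
      show "(?f i has_field_derivative ?f (Suc i) x) (at x within cball 0 (1 / 2))"
        if "x \<in> cball 0 (1 / 2)" for i x
        using holomorphic_derivI[OF hol[of i] open_ball, of x "cball 0 (1 / 2)"] that by simp
    qed (use C that in \<open>auto simp: numeral_2_eq_2\<close>)
    moreover have "deriv reduced_poly 0 = 0" by (rule DERIV_imp_deriv[OF reduced_poly_deriv_0])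
    moreover have "reduced_poly 0 = 0" by (simp add: reduced_poly_def u_nome_0)
    ultimately show ?thesis by (simp add: numeral_2_eq_2)
  qed
  then show ?thesis by (rule that)
qed

lemma defect_nome_tendsto_0: "(defect_nome \<longlongrightarrow> 0) (at 0)"
proof -
  obtain C where C: "\<And>q. norm q \<le> 1 / 2 \<Longrightarrow> norm (reduced_poly q) \<le> C * norm q ^ 2"
    using reduced_poly_bound by blast
  let ?a = "\<lambda>q. u_nome q * u_nome (q\<^sup>2)"
  show ?thesis
  proof (rule Lim_null_comparison)
    have "isCont u_nome 0" "isCont (\<lambda>q. u_nome (q\<^sup>2)) 0"
      using u_nome_deriv_0 u_nome_square_deriv_0 DERIV_isCont by blast+
    then have lims: "u_nome \<midarrow>0\<rightarrow> 1" "(\<lambda>q. u_nome (q\<^sup>2)) \<midarrow>0\<rightarrow> 1"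
      by (auto simp: isCont_def u_nome_0)
    have "(\<lambda>q. C ^ 2 * norm q / norm (?a q) ^ 3) \<midarrow>0\<rightarrow> C ^ 2 * norm (0 :: complex) / norm (1 * 1 :: complex) ^ 3"
      by (intro tendsto_intros lims) auto
    then show "((\<lambda>q. C ^ 2 * norm q / norm (?a q) ^ 3) \<longlongrightarrow> 0) (at 0)" by simp
    have "norm (defect_nome q) \<le> C ^ 2 * norm q / norm (?a q) ^ 3"
      if q: "q \<noteq> 0" "norm q < 1 / 2" for q
    proof -
      have nz: "?a q \<noteq> 0" using q by (simp add: u_nome_nonzero norm_power_less_one)
      have "defect_nome q = (q ^ 3 * reduced_poly q) ^ 2 / (q ^ 3 * ?a q) ^ 3"
        unfolding defect_nome_def defect_of_def modular_poly_eq_reduced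
        by (simp add: power2_eq_square power3_eq_cube mult_ac)
      \<comment> \<open>A pole of order 3 seems to remain, but the square of
        \<open>reduced_poly\<close> is O(q^4).\<close>
      also have "\<dots> = reduced_poly q ^ 2 / (q ^ 3 * ?a q ^ 3)"
        using q nz by (simp add: field_simps)
      finally have "norm (defect_nome q) = norm (reduced_poly q) ^ 2 / (norm q ^ 3 * norm (?a q) ^ 3)"
        by (simp add: norm_divide norm_mult norm_power)
      also have "\<dots> \<le> (C * norm q ^ 2) ^ 2 / (norm q ^ 3 * norm (?a q) ^ 3)"
        using C[of q] q by (intro divide_right_mono power_mono) auto
      also have "\<dots> = C ^ 2 * norm q / norm (?a q) ^ 3"
        using q nz by (simp add: field_simps power2_eq_square power3_eq_cube)
      finally show ?thesis .
    qed
    then show "\<forall>\<^sub>F q in at 0. norm (defect_nome q) \<le> C ^ 2 * norm q / norm (?a q) ^ 3"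
      unfolding eventually_at by (intro exI[of _ "1 / 2"]) auto
  qed
qed

lemma defect_small_near_cusp:
  assumes "\<epsilon> > 0"
  obtains Y where "\<And>\<tau>. Im \<tau> > Y \<Longrightarrow> norm (defect \<tau>) < \<epsilon>"
proof -
  obtain d where d: "d > 0" "\<And>q. q \<noteq> 0 \<Longrightarrow> norm q < d \<Longrightarrow> norm (defect_nome q) < \<epsilon>"
    using tendstoD[OF defect_nome_tendsto_0 assms] unfolding eventually_at by (auto simp: dist_norm)
  have "norm (defect \<tau>) < \<epsilon>" if "Im \<tau> > - ln d / (2 * pi)" for \<tau>
  proof -
    have "- 2 * pi * Im \<tau> < ln d" using that by (simp add: field_simps)
    then have "exp (- 2 * pi * Im \<tau>) < d" using d(1) by (metis exp_less_cancel_iff exp_ln)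
    then show ?thesis unfolding defect_eq_nome by (intro d(2)) auto
  qed
  then show ?thesis by (rule that)
qed

section \<open>Maximum principle and conclusion\<close>

theorem defect_eq_0:
  assumes "Im \<tau> > 0"
  shows "defect \<tau> = 0"
proof (rule ccontr)
  assume nz: "defect \<tau> \<noteq> 0"
  define H where "H = {z. Im z > 0}"
  have H: "open H" "connected H"
    unfolding H_def by (auto intro: open_halfspace_Im_gt convex_connected convex_halfspace_Im_gt)
  obtain Y where Y: "\<And>z. Im z > Y \<Longrightarrow> norm (defect z) < norm (defect \<tau>)"
    using defect_small_near_cusp[of "norm (defect \<tau>)"] nz by auto
  \<comment> \<open>Every point has a representative of equal modulus in this box or above it, and
    above it the modulus is smaller than at \<open>\<tau>\<close>, whose own representative lies in
    the box. So the maximum over the box is the maximum over the half plane.\<close>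
  define K where "K = cbox (Complex 0 (1 / 100)) (Complex 1 Y)"
  have K: "z \<in> K \<longleftrightarrow> 0 \<le> Re z \<and> Re z \<le> 1 \<and> 1 / 100 \<le> Im z \<and> Im z \<le> Y" for z
    unfolding K_def by (auto simp: in_cbox_complex_iff)
  have "K \<subseteq> H" by (auto simp: K H_def)
  then have cont: "continuous_on K (\<lambda>z. norm (defect z))"
    using defect_holomorphic unfolding H_def
    by (intro continuous_on_norm holomorphic_on_imp_continuous_on) (rule holomorphic_on_subset)
  obtain z0 where z0: "0 \<le> Re z0" "Re z0 \<le> 1" "1 / 100 \<le> Im z0" "norm (defect z0) = norm (defect \<tau>)"
    using defect_reduce[OF assms] by blast
  then have "z0 \<in> K" unfolding K using Y[of z0] by force
  then obtain z1 where z1: "z1 \<in> K" "\<And>z. z \<in> K \<Longrightarrow> norm (defect z) \<le> norm (defect z1)"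
    using continuous_attains_sup[of K "\<lambda>z. norm (defect z)"] cont K_def by auto
  have "norm (defect z) \<le> norm (defect z1)" if "z \<in> H" for z
  proof -
    obtain z' where z': "0 \<le> Re z'" "Re z' \<le> 1" "1 / 100 \<le> Im z'" "norm (defect z') = norm (defect z)"
      by (rule defect_reduce[of z]) (use \<open>z \<in> H\<close> in \<open>auto simp: H_def\<close>)
    show ?thesis
    proof (cases "Im z' \<le> Y")
      case True
      then show ?thesis using z1(2)[of z'] z' by (simp add: K)
    next
      case False
      then have "norm (defect z) < norm (defect \<tau>)" using Y[of z'] z'(4) by simp
      then show ?thesis using z1(2)[OF \<open>z0 \<in> K\<close>] z0(4) by simp
    qed
  qed
  then have "defect constant_on H"
    using maximum_modulus_principle[of defect H H z1] defect_holomorphic H z1(1) \<open>K \<subseteq> H\<close>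
    unfolding H_def[symmetric] by blast
  then obtain c where c: "\<And>z. z \<in> H \<Longrightarrow> defect z = c" by (auto simp: constant_on_def)
  \<comment> \<open>A point above \<open>Y\<close> at which the constant would be smaller in modulus
    than at \<open>\<tau>\<close>; the maximum with 0 keeps it in the half plane whatever the sign
    of \<open>Y\<close>.\<close>
  have "\<i> * of_real (max Y 0 + 1) \<in> H" by (simp add: H_def)
  moreover have "norm (defect (\<i> * of_real (max Y 0 + 1))) < norm (defect \<tau>)" by (rule Y) simp
  moreover have "\<tau> \<in> H" using assms by (simp add: H_def)
  ultimately show False using c by auto
qed

theorem theorem3p5:
  fixes q s P Q :: complex and w :: "nat \<Rightarrow> complex"
  assumes "0 < norm q" and "norm q < 1"
    and "s ^ 2 = q"
    and "q \<in> \<real> \<and> 0 < Re q \<longrightarrow> s \<in> \<real> \<and> 0 < Re s"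
    and "\<And>r. r \<in> {1, 2} \<Longrightarrow>
           w r = s ^ r * (f_sub q r * f_sub q (21 * r)) / (f_sub q (3 * r) * f_sub q (7 * r))"
    and "P = w 1 * w 2"
    and "Q = w 1 / w 2"
  shows "P + 1 / P = Q ^ 3 + 1 / Q ^ 3 + 4 * (Q + 1 / Q)"
proof -
  define \<tau> where "\<tau> = Ln q / (2 * pi * \<i>)"
  have "q \<noteq> 0" using assms(1) by auto
  then have q: "exp (2 * pi * \<i> * \<tau>) = q" by (simp add: \<tau>_def)
  have "exp (- 2 * pi * Im \<tau>) = norm q" by (metis norm_nome q)
  then have "Im \<tau> > 0" using assms(2)
    by (metis exp_less_one_iff mult_minus_left mult_pos_pos neg_less_0_iff_less pi_gt_zero
        zero_less_mult_pos zero_less_numeral)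
  define a where "a = w 1"
  define b where "b = w 2"
  have "a = s * (f_minus q * f_minus (q ^ 21)) / (f_minus (q ^ 3) * f_minus (q ^ 7))"
    using assms(5)[of 1] by (simp add: a_def f_sub_def)
  then have "a ^ 2 = w_sq \<tau>"
    unfolding w_sq_eq_nome q u_nome_def by (simp add: power_mult_distrib power_divide assms(3))
  moreover have "b = q * (f_minus (q ^ 2) * f_minus ((q ^ 2) ^ 21)) / (f_minus ((q ^ 2) ^ 3) * f_minus ((q ^ 2) ^ 7))"
    using assms(5)[of 2] by (simp add: b_def f_sub_def assms(3) flip: power_mult)
  then have "b ^ 2 = w_sq (2 * \<tau>)"
    unfolding w_sq_eq_nome nome_double q u_nome_def by (simp add: power_mult_distrib power_divide)
  ultimately have nz: "a \<noteq> 0" "b \<noteq> 0" and "modular_poly (a ^ 2) (b ^ 2) = 0"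
    using w_sq_nonzero[of \<tau>] w_sq_nonzero[of "2 * \<tau>"] \<open>Im \<tau> > 0\<close> defect_eq_0[of \<tau>]
    by (auto simp: defect_def defect_of_def)
  then have "(a ^ 2 + b ^ 2) ^ 3 = a ^ 2 * b ^ 2 * (1 - a ^ 2) * (1 - b ^ 2)"
    by (simp add: modular_poly_def)
  \<comment> \<open>The coefficient 4 is 3 from the cube plus 1 moved over from the product.
    Division by a^3 b^3 then makes every monomial a power of a b or of a/b.\<close>
  then have "a ^ 4 * b ^ 4 + a ^ 2 * b ^ 2 = a ^ 6 + b ^ 6 + 4 * (a ^ 4 * b ^ 2 + a ^ 2 * b ^ 4)"
    by algebra
  then have "(a ^ 4 * b ^ 4 + a ^ 2 * b ^ 2) / (a ^ 3 * b ^ 3) =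
      (a ^ 6 + b ^ 6 + 4 * (a ^ 4 * b ^ 2 + a ^ 2 * b ^ 4)) / (a ^ 3 * b ^ 3)" by simp
  moreover have "(a ^ 4 * b ^ 4 + a ^ 2 * b ^ 2) / (a ^ 3 * b ^ 3) = a * b + 1 / (a * b)"
    using nz by (simp add: field_simps power_numeral_reduce)
  moreover have "(a ^ 6 + b ^ 6 + 4 * (a ^ 4 * b ^ 2 + a ^ 2 * b ^ 4)) / (a ^ 3 * b ^ 3)
      = (a / b) ^ 3 + 1 / (a / b) ^ 3 + 4 * (a / b + 1 / (a / b))"
    using nz by (simp add: field_simps power_numeral_reduce)
  ultimately have "a * b + 1 / (a * b) = (a / b) ^ 3 + 1 / (a / b) ^ 3 + 4 * (a / b + 1 / (a / b))"
    by metis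
  then show ?thesis unfolding assms(6,7) a_def b_def .
qed

end
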